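(* Suppose that for each prime $p$ and each residue class $a\bmod p$ with $(a,p)=1$ a complex number $V(a;p)$ is given. Extend $V$ to squarefree $q$ and reduced residues $a\bmod q$ by twisted multiplicativity: if $q=q_1q_2$ with $(q_1,q_2)=1$ then $V(a;q_1q_2)=V(a\overline{q_1};q_2)V(a\overline{q_2};q_1)$, where $q_1\overline{q_1}\equiv1\bmod q_2$ and $q_2\overline{q_2}\equiv 1\bmod q_1$; set $V(a;q)=0$ if $q$ is not squarefree or $(a,q)>1$. For each prime $p$ let $G(p)\geq g(p)\geq 0$ be real numbers with $$\max_{(a,p)=1}|V(a;p)|\leq G(p),\qquad \frac1p\sum_{(a,p)=1}|V(a;p)|\leq g(p).$$ Let $M>0$ be such that $G(p)\leq M$ for all primes $p$. Then for any fixed integer $a\geq1$ and all large $x$, $$\sum_{q\le x}|V(a;q)|\ll \frac{x}{\log x}\prod_{p\le x}\Bigl(1+\frac{g(p)}{p}\Bigr)(\log\log x)^{M},$$ where the implied constant may depend on $M$. *)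

theory Defs
  imports
    "HOL-Analysis.Analysis"
    "HOL-Number_Theory.Number_Theory"
    "HOL-Computational_Algebra.Squarefree"
begin

text \<open>
  A function on pairs (residue class \<open>a mod q\<close>, modulus \<open>q\<close>) is a function \<open>V a q\<close> of an integer
  representative \<open>a\<close> which is periodic in \<open>a\<close> modulo \<open>q\<close>. The inverse of \<open>q1\<close> modulo \<open>q2\<close> is
  an arbitrary integer \<open>b1\<close> with \<open>q1 * b1 \<equiv> 1 (mod q2)\<close>; by periodicity its choice is immaterial.

  No value is prescribed at modulus 1: taking \<open>q1 = 1\<close> in the multiplicativity relation forces
  \<open>V a 1 = 1\<close> as soon as \<open>V\<close> does not vanish on all prime moduli, and \<open>V a 1 \<in> {0, 1}\<close> always.
\<close>

definition twisted_multiplicative :: "(int \<Rightarrow> nat \<Rightarrow> complex) \<Rightarrow> bool" where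
  "twisted_multiplicative V \<longleftrightarrow>
     (\<forall>q a b. [a = b] (mod int q) \<longrightarrow> V a q = V b q) \<and>
     (\<forall>q1 q2 a b1 b2.
        squarefree (q1 * q2) \<longrightarrow> coprime q1 q2 \<longrightarrow> coprime a (int (q1 * q2)) \<longrightarrow>
        [int q1 * b1 = 1] (mod int q2) \<longrightarrow> [int q2 * b2 = 1] (mod int q1) \<longrightarrow>
        V a (q1 * q2) = V (a * b1) q2 * V (a * b2) q1) \<and>
     (\<forall>q a. \<not> squarefree q \<or> \<not> coprime a (int q) \<longrightarrow> V a q = 0)"

text \<open>
  The values at prime moduli are unconstrained: any function on the reduced residue classes modulo
  the primes has a twisted multiplicative extension.
\<close>

lemma twisted_multiplicative_extension_exists:
  fixes V0 :: "int \<Rightarrow> nat \<Rightarrow> complex"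
  assumes per: "\<And>p a b. prime p \<Longrightarrow> [a = b] (mod int p) \<Longrightarrow> V0 a p = V0 b p"
  shows "\<exists>V. twisted_multiplicative V \<and>
           (\<forall>p a. prime p \<longrightarrow> coprime a (int p) \<longrightarrow> V a p = V0 a p)"
proof -
  define iv :: "nat \<Rightarrow> nat \<Rightarrow> int" where "iv n p = (SOME b. [int n * b = 1] (mod int p))" for n p
  have iv: "[int n * iv n p = 1] (mod int p)" if "coprime n p" for n p
    unfolding iv_def using that by (metis (mono_tags, lifting) someI_ex cong_solve_coprime_int
        coprime_int_iff)
  have iv_eq: "[iv n p = b] (mod int p)" if "[int n * b = 1] (mod int p)" for n p b
  proof -
    have "coprime n p"
      using that by (metis coprime_iff_invertible_int coprime_int_iff)
    then have "[int n * iv n p = int n * b] (mod int p)"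
      using iv that cong_sym cong_trans by blast
    then show ?thesis
      using \<open>coprime n p\<close> cong_mult_lcancel coprime_int_iff by blast
  qed
  define V where "V a q = (if squarefree q \<and> coprime a (int q)
      then \<Prod>p\<in>prime_factors q. V0 (a * iv (q div p) p) p else 0)" for a q
  have half: "(\<Prod>p\<in>prime_factors q2. V0 (a * iv (q1 * q2 div p) p) p) = V (a * b1) q2"
    if sq: "squarefree (q1 * q2)" and cop: "coprime q1 q2" and ca: "coprime a (int (q1 * q2))"
      and b1: "[int q1 * b1 = 1] (mod int q2)" for q1 q2 a b1
  proof -
    have q20: "q2 \<noteq> 0" and q10: "q1 \<noteq> 0" using sq by (auto intro: ccontr)
    have sq2: "squarefree q2" using sq squarefree_multD(2) by blast
    have "coprime b1 (int q2)"
      using b1 by (metis coprime_iff_invertible_int mult.commute)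
    then have c2: "coprime (a * b1) (int q2)"
      using ca by (simp add: coprime_commute)
    have "V0 (a * iv (q1 * q2 div p) p) p = V0 (a * b1 * iv (q2 div p) p) p"
      if p: "p \<in> prime_factors q2" for p
    proof -
      have pp: "prime p" and pd: "p dvd q2" using p by auto
      obtain m where m: "q2 = p * m" using pd by auto
      have p0: "p > 0" using pp prime_gt_0_nat by blast
      have "\<not> p dvd m"
      proof
        assume "p dvd m"
        then have "p\<^sup>2 dvd q2" unfolding m power2_eq_square by (rule mult_dvd_mono[OF dvd_refl])
        then have "p dvd 1" using sq2 unfolding squarefree_def by blast
        then show False using pp not_prime_unit by blast
      qed
      then have "coprime p m" using pp prime_imp_coprime by blast
      then have im: "[int m * iv m p = 1] (mod int p)" by (intro iv) (simp add: coprime_commute)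
      have ib: "[int q1 * b1 = 1] (mod int p)"
        using b1 m by (metis cong_dvd_modulus dvd_triv_left of_nat_mult)
      have "[(int q1 * b1) * (int m * iv m p) = 1 * 1] (mod int p)"
        using cong_mult[OF ib im] .
      then have "[int (q1 * m) * (b1 * iv m p) = 1] (mod int p)"
        by (simp add: ac_simps)
      then have "[iv (q1 * m) p = b1 * iv m p] (mod int p)" by (rule iv_eq)
      then have "[a * iv (q1 * m) p = a * (b1 * iv m p)] (mod int p)"
        by (rule cong_scalar_left)
      moreover have "q1 * q2 div p = q1 * m" "q2 div p = m" using m p0 by simp_all
      ultimately show ?thesis using per[OF pp] by (simp add: mult.assoc)
    qed
    then show ?thesis unfolding V_def using sq2 c2 by (simp cong: prod.cong)
  qed
  have "twisted_multiplicative V"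
    unfolding twisted_multiplicative_def
  proof (intro conjI allI impI)
    fix q and a b :: int
    assume ab: "[a = b] (mod int q)"
    have c: "coprime a (int q) = coprime b (int q)"
      using ab cong_imp_coprime cong_sym by blast
    have "V0 (a * k) p = V0 (b * k) p" if p: "p \<in> prime_factors q" for p k
    proof -
      have "prime p" "int p dvd int q" using p by auto
      then show ?thesis
        using per ab cong_dvd_modulus cong_scalar_right by blast
    qed
    then show "V a q = V b q" unfolding V_def using c by (simp cong: prod.cong)
  next
    fix q1 q2 and a b1 b2 :: int
    assume sq: "squarefree (q1 * q2)" and cop: "coprime q1 q2"
      and ca: "coprime a (int (q1 * q2))"
      and b1: "[int q1 * b1 = 1] (mod int q2)" and b2: "[int q2 * b2 = 1] (mod int q1)"
    have nz: "q1 \<noteq> 0" "q2 \<noteq> 0" using sq by (auto intro: ccontr)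
    have un: "prime_factors (q1 * q2) = prime_factors q2 \<union> prime_factors q1"
      using nz by (simp add: prime_factors_product Un_commute)
    have dj: "prime_factors q2 \<inter> prime_factors q1 = {}"
      using cop by (metis Int_emptyI coprime_common_divisor_nat in_prime_factors_iff not_prime_1
          nat_dvd_1_iff_1 coprime_def)
    have "V a (q1 * q2) = (\<Prod>p\<in>prime_factors (q1 * q2). V0 (a * iv (q1 * q2 div p) p) p)"
      using sq ca by (simp add: V_def)
    also have "\<dots> = (\<Prod>p\<in>prime_factors q2. V0 (a * iv (q1 * q2 div p) p) p) *
                    (\<Prod>p\<in>prime_factors q1. V0 (a * iv (q2 * q1 div p) p) p)"
      unfolding un using dj by (subst prod.union_disjoint) (auto simp: mult.commute)
    also have "\<dots> = V (a * b1) q2 * V (a * b2) q1"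
      using half[OF sq cop ca b1] half[of q2 q1 a b2] sq cop ca b2
      by (simp add: mult.commute coprime_commute)
    finally show "V a (q1 * q2) = V (a * b1) q2 * V (a * b2) q1" .
  next
    fix q and a :: int
    assume "\<not> squarefree q \<or> \<not> coprime a (int q)"
    then show "V a q = 0" by (auto simp: V_def)
  qed
  moreover have "V a p = V0 a p" if p: "prime p" and a: "coprime a (int p)" for p a
  proof -
    have "[iv 1 p = 1] (mod int p)" by (rule iv_eq) simp
    then have "[a * iv 1 p = a] (mod int p)" using cong_scalar_left by fastforce
    then have "V0 (a * iv 1 p) p = V0 a p" using per p by blast
    moreover have "p div p = 1" "squarefree p"
      using p by (auto simp: prime_gt_0_nat squarefree_prime)
    ultimately show ?thesis
      using p a by (simp add: V_def prime_prime_factors)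
  qed
  ultimately show ?thesis by blast
qed

end

theory Submission
  imports Defs
begin

text \<open>
  Shiu's method, with \<open>M\<close> enlarged to a power of 2. Bounding \<open>\<bar>V(a;q)\<bar>\<close> by \<open>M ^ \<omega>(q)\<close>, a power of \<open>q\<close>,
  disposes of \<open>q \<le> x powr \<kappa>\<close> for a small \<open>\<kappa>\<close>. Any larger squarefree \<open>q\<close> is cut at the prime \<open>p\<close> where
  the product of its prime factors, taken in increasing order, first exceeds \<open>x powr \<kappa>\<close>: then
  \<open>q = r t\<close> with \<open>r \<le> x powr \<kappa> < r p\<close>, the primes of \<open>r\<close> are below \<open>p\<close>, those of \<open>t\<close> are at least
  \<open>p\<close>, and \<open>t\<close> has at most \<open>v\<close> of them, where \<open>v\<close> is the integer part of \<open>ln x / ln p\<close>. In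
  \<open>V(a;r t) = V(a t';r) V(a r';t)\<close>, with inverses \<open>t'\<close> and \<open>r'\<close>, the second factor is at most \<open>M ^ v\<close>
  and the first depends only on \<open>t\<close> modulo \<open>r\<close>. Selberg's sieve bounds the number of such \<open>t\<close> in
  each residue class by a multiple of \<open>v x / (r\<^sup>2 ln x)\<close>, up to a product of \<open>1 + 1 / l\<close> over the primes
  \<open>l\<close> dividing \<open>r\<close>, and the sum of \<open>\<bar>V(c;r)\<bar>\<close> over the classes \<open>c\<close> is at most the product of \<open>l g(l)\<close>.
  Rankin's trick makes the sum over \<open>r\<close> decay exponentially in \<open>v\<close>, fast enough to beat \<open>v M ^ v\<close>.
\<close>

section \<open>Products over squarefree numbers and primes\<close>

lemma squarefree_mult_imp_coprime:
  fixes a b :: nat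
  assumes "squarefree (a * b)"
  shows "coprime a b"
proof (rule coprimeI)
  fix c assume "c dvd a" "c dvd b"
  then have "c\<^sup>2 dvd a * b" unfolding power2_eq_square by (rule mult_dvd_mono)
  then show "is_unit c" using squarefreeD[OF assms] by simp
qed

lemma prod_prime_factors_squarefree:
  fixes n :: nat
  assumes "squarefree n"
  shows "\<Prod>(prime_factors n) = n"
proof -
  have n0: "n \<noteq> 0" using assms by (metis not_squarefree_0)
  have "\<Prod>(prime_factors n) = (\<Prod>p\<in>prime_factors n. p ^ multiplicity p n)"
    using assms n0 by (intro prod.cong) (auto simp: squarefree_factorial_semiring')
  also have "\<dots> = n" using n0 by (simp add: prime_factorization_nat[symmetric])
  finally show ?thesis .
qed

lemma prime_factors_prod_primes:
  fixes X :: "nat set"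
  assumes "finite X" "\<And>p. p \<in> X \<Longrightarrow> prime p"
  shows "prime_factors (\<Prod>X) = X"
  using assms
proof (induction X rule: finite_induct)
  case (insert p X)
  have "\<Prod>X \<noteq> 0" using insert by (metis insertI2 not_prime_0 prod_zero_iff)
  moreover have "prime p" using insert by simp
  ultimately have "prime_factors (p * \<Prod>X) = insert p (prime_factors (\<Prod>X))"
    by (subst prime_factors_product) (auto simp: prime_prime_factors)
  then show ?case using insert by simp
qed auto

lemma inj_on_prime_factors_squarefree:
  "inj_on (prime_factors :: nat \<Rightarrow> nat set) {n. squarefree n}"
  by (rule inj_on_inverseI[where g = "\<lambda>X. \<Prod>X"]) (simp add: prod_prime_factors_squarefree)

lemma prod_one_plus:
  fixes f :: "'a \<Rightarrow> 'b :: comm_ring_1"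
  assumes "finite P"
  shows "(\<Prod>p\<in>P. 1 + f p) = (\<Sum>X\<in>Pow P. \<Prod>p\<in>X. f p)"
  using prod_add[OF assms, of f "\<lambda>_. 1"] by (simp add: add.commute)

text \<open>Distinct squarefree numbers have distinct sets of prime factors, so the left side is
  part of the expansion of the product over all subsets of \<open>P\<close>, whose other terms are
  nonnegative.\<close>

lemma sum_squarefree_le_prod:
  fixes f :: "nat \<Rightarrow> real"
  assumes "finite P" "\<And>r. r \<in> R \<Longrightarrow> squarefree r \<and> prime_factors r \<subseteq> P"
    and "\<And>p. p \<in> P \<Longrightarrow> f p \<ge> 0"
  shows "(\<Sum>r\<in>R. \<Prod>p\<in>prime_factors r. f p) \<le> (\<Prod>p\<in>P. 1 + f p)"
proof -
  have inj: "inj_on prime_factors R"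
    using inj_on_prime_factors_squarefree by (rule inj_on_subset) (use assms in auto)
  have "(\<Sum>r\<in>R. \<Prod>p\<in>prime_factors r. f p) = (\<Sum>X\<in>prime_factors ` R. \<Prod>p\<in>X. f p)"
    by (simp add: sum.reindex[OF inj])
  also have "\<dots> \<le> (\<Sum>X\<in>Pow P. \<Prod>p\<in>X. f p)"
    using assms by (intro sum_mono2) (auto intro!: prod_nonneg)
  finally show ?thesis using prod_one_plus[OF assms(1), of f] by simp
qed

text \<open>Divisors of a squarefree number correspond to subsets of its primes. Used with
  \<open>f p = - 1\<close> for the basic Moebius identity and with \<open>f p = 1 / real p\<close>
  for the sum of inverse divisors.\<close>

lemma sum_dvd_squarefree_eq_prod:
  fixes f :: "nat \<Rightarrow> real"
  assumes "squarefree n"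
  shows "(\<Sum>d | d dvd n. \<Prod>p\<in>prime_factors d. f p) = (\<Prod>p\<in>prime_factors n. 1 + f p)"
proof -
  have n0: "n \<noteq> 0" using assms by (metis not_squarefree_0)
  have bij: "bij_betw prime_factors {d. d dvd n} (Pow (prime_factors n))"
  proof (rule bij_betwI[where g = "\<lambda>X. \<Prod>X"])
    show "prime_factors \<in> {d. d dvd n} \<rightarrow> Pow (prime_factors n)"
      using n0 dvd_prime_factors by blast
    show "Prod \<in> Pow (prime_factors n) \<rightarrow> {d. d dvd n}"
    proof (intro funcsetI CollectI)
      fix X assume "X \<in> Pow (prime_factors n)"
      then have "\<Prod>X dvd \<Prod>(prime_factors n)"
        by (intro prod_dvd_prod_subset) auto
      then show "\<Prod>X dvd n" using prod_prime_factors_squarefree[OF assms] by simp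
    qed
    show "\<Prod>(prime_factors d) = d" if "d \<in> {d. d dvd n}" for d
      using that assms squarefree_mono by (auto intro: prod_prime_factors_squarefree)
    show "prime_factors (\<Prod>X) = X" if "X \<in> Pow (prime_factors n)" for X
      using that by (intro prime_factors_prod_primes) (auto intro: finite_subset)
  qed
  have "(\<Sum>d | d dvd n. \<Prod>p\<in>prime_factors d. f p) = (\<Sum>X\<in>Pow (prime_factors n). \<Prod>p\<in>X. f p)"
    using sum.reindex_bij_betw[OF bij, of "\<lambda>X. \<Prod>p\<in>X. f p"] by simp
  then show ?thesis by (simp add: prod_one_plus)
qed

section \<open>Inverse squares, prime powers in factorials, and a weak Mertens bound\<close>

lemma sum_inverse_squares_le:
  "(\<Sum>m=1..n. 1 / (real m)\<^sup>2) \<le> 2"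
proof -
  \<comment> \<open>Subtracting \<open>1 / real n\<close> makes the induction telescope.\<close>
  have "(\<Sum>m=1..n. 1 / (real m)\<^sup>2) \<le> 2 - 1 / real n" if "n > 0" for n
    using that
  proof (induction n)
    case (Suc n)
    show ?case
    proof (cases "n = 0")
      case False
      have "1 / (real (Suc n))\<^sup>2 \<le> 1 / (real n * real (Suc n))"
        using False by (intro divide_left_mono) (auto simp: power2_eq_square intro: mult_right_mono)
      also have "\<dots> = 1 / real n - 1 / real (Suc n)"
        using False by (simp add: field_simps)
      finally show ?thesis using Suc False by simp
    qed auto
  qed auto
  from this[of n] show ?thesis
    by (cases "n = 0") (auto intro: order_trans)
qed

lemma prime_power_dvd_fact:
  fixes p :: nat
  assumes "p > 0"
  shows "p ^ k dvd fact (p * k)"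
proof (induction k)
  case (Suc k)
  have "p * p ^ k dvd fact p * fact (p * k)"
    using Suc assms by (intro mult_dvd_mono) (auto intro: dvd_fact)
  also have "\<dots> dvd fact (p + p * k)" by (rule fact_fact_dvd_fact)
  finally show ?case by simp
qed auto

lemma prod_dvd_of_coprime:
  fixes f :: "'a \<Rightarrow> nat"
  assumes "finite A" "\<And>a. a \<in> A \<Longrightarrow> f a dvd n"
    and "\<And>a b. a \<in> A \<Longrightarrow> b \<in> A \<Longrightarrow> a \<noteq> b \<Longrightarrow> coprime (f a) (f b)"
  shows "(\<Prod>a\<in>A. f a) dvd n"
  using assms
proof (induction A rule: finite_induct)
  case (insert a A)
  have "coprime (f a) (\<Prod>a\<in>A. f a)"
    using insert by (intro prod_coprime_right) auto
  then show ?case using insert by (simp add: divides_mult)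
qed auto

text \<open>Weak form of Mertens' first theorem: compare the primes with \<open>n! \<le> n ^ n\<close>, using
  \<open>\<lfloor>n / p\<rfloor> \<ge> n / (2 p)\<close> for \<open>p \<le> n\<close>.\<close>

lemma sum_ln_prime_over_prime_le:
  fixes n :: nat
  assumes "n > 0"
  shows "(\<Sum>p | prime p \<and> p \<le> n. ln (real p) / real p) \<le> 2 * ln (real n)"
proof -
  let ?P = "{p. prime p \<and> p \<le> n}"
  have fin: "finite ?P" by (rule finite_subset[of _ "{..n}"]) auto
  have pos: "ln (real p) \<ge> 0" if "p \<in> ?P" for p
    using that prime_ge_1_nat[of p] by simp
  \<comment> \<open>Each factor divides \<open>fact n\<close> because
    \<open>p * (n div p) \<le> n\<close>; factors for different primes are coprime, so their product
    divides it too.\<close>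
  have "(\<Prod>p\<in>?P. p ^ (n div p)) dvd fact n"
  proof (rule prod_dvd_of_coprime[OF fin])
    show "p ^ (n div p) dvd fact n" if "p \<in> ?P" for p
    proof -
      have "p ^ (n div p) dvd fact (p * (n div p))"
        using that by (intro prime_power_dvd_fact) (auto simp: prime_gt_0_nat)
      also have "\<dots> dvd fact n" by (intro fact_dvd) simp
      finally show ?thesis .
    qed
  qed (auto intro: primes_coprime)
  then have "(\<Prod>p\<in>?P. p ^ (n div p)) \<le> fact n" by (rule dvd_imp_le) simp
  also have "\<dots> \<le> n ^ n" using fact_le_power[of n, where ?'a = nat] by simp
  finally have le: "real (\<Prod>p\<in>?P. p ^ (n div p)) \<le> real (n ^ n)" by (simp only: of_nat_le_iff)
  have "real n / 2 * (\<Sum>p\<in>?P. ln (real p) / real p) = (\<Sum>p\<in>?P. real n / (2 * real p) * ln (real p))"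
    by (simp add: sum_distrib_left)
  also have "\<dots> \<le> (\<Sum>p\<in>?P. real (n div p) * ln (real p))"
  proof (intro sum_mono mult_right_mono pos)
    fix p assume p: "p \<in> ?P"
    then have p0: "p > 0" by (auto simp: prime_gt_0_nat)
    have "n div p > 0" using p p0 by (simp add: div_greater_zero_iff)
    then have "p * 1 \<le> p * (n div p)" by (intro mult_le_mono) auto
    moreover have "n < p * (n div p) + p"
      using p0 by (metis add.commute add_less_cancel_right dividend_less_times_div mult.commute mult_Suc_right)
    ultimately have "n \<le> 2 * (p * (n div p))" by linarith
    then have "real n \<le> real (2 * (p * (n div p)))" by (rule of_nat_mono)
    then show "real n / (2 * real p) \<le> real (n div p)"
      using p0 by (simp add: field_simps)
  qed
  also have "\<dots> = ln (real (\<Prod>p\<in>?P. p ^ (n div p)))"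
    by (subst of_nat_prod, subst ln_prod) (auto simp: fin ln_realpow prime_gt_0_nat)
  also have "\<dots> \<le> ln (real (n ^ n))"
    using le assms by (subst ln_le_cancel_iff) (auto simp: prime_gt_0_nat intro!: prod_pos)
  also have "\<dots> = real n * ln (real n)" using assms by (simp add: ln_realpow)
  finally show ?thesis using assms by (simp add: field_simps)
qed

section \<open>Selberg's sieve in arithmetic progressions\<close>

lemma div_eq_div_pred:
  fixes y Q :: int
  assumes "Q > 0"
  shows "y div Q = (y - 1) div Q + of_bool (Q dvd y)"
proof (cases "Q dvd y")
  case True
  then obtain k where k: "y = Q * k" by auto
  have "(y - 1) div Q = k - 1"
    by (rule int_div_pos_eq[where r = "Q - 1"]) (use assms k in \<open>auto simp: algebra_simps\<close>)
  then show ?thesis using k assms by simp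
next
  case False
  then have m: "y mod Q > 0" using assms
    by (metis dvd_eq_mod_eq_0 order_le_less pos_mod_sign)
  have "(y - 1) div Q = y div Q"
    by (rule int_div_pos_eq[where r = "y mod Q - 1"])
      (use assms m pos_mod_bound[OF assms, of y] in \<open>auto simp: algebra_simps\<close>)
  then show ?thesis using False by simp
qed

text \<open>The count telescopes to a difference of two floors. Each floor falls short of its
  quotient by an amount in the interval from 0 to 1, so the two errors differ by at most 1.\<close>

lemma card_cong_interval_bound:
  fixes e :: int
  assumes "Q > 0"
  shows "\<bar>real (card {t \<in> {1..T}. [int t = e] (mod int Q)}) - real T / real Q\<bar> \<le> 1"
proof -
  define c where "c T = card {t \<in> {1..T}. [int t = e] (mod int Q)}" for T
  have eq: "int (c T) = (int T - e) div int Q - (- e) div int Q"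
  proof (induction T)
    case (Suc T)
    have "c (Suc T) = c T + of_bool ([int (Suc T) = e] (mod int Q))"
    proof -
      have "{t \<in> {1..Suc T}. [int t = e] (mod int Q)} =
        (if [int (Suc T) = e] (mod int Q) then insert (Suc T) {t \<in> {1..T}. [int t = e] (mod int Q)}
         else {t \<in> {1..T}. [int t = e] (mod int Q)})"
        by (auto simp: le_Suc_eq)
      then show ?thesis unfolding c_def by auto
    qed
    moreover have "[int (Suc T) = e] (mod int Q) \<longleftrightarrow> int Q dvd int (Suc T) - e"
      by (simp add: cong_iff_dvd_diff)
    moreover have "(int (Suc T) - e) div int Q =
        (int T - e) div int Q + of_bool (int Q dvd int (Suc T) - e)"
      using div_eq_div_pred[of "int Q" "int (Suc T) - e"] assms by (simp add: algebra_simps)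
    ultimately show ?case using Suc by simp
  qed (simp add: c_def)
  have fl: "real_of_int (z div int Q) \<le> real_of_int z / real Q \<and>
      real_of_int z / real Q < real_of_int (z div int Q) + 1" for z
    using floor_divide_of_int_eq[of z "int Q", where ?'a = real] 
    by (metis floor_correct of_int_add of_int_1 of_int_of_nat_eq)
  have "real (c T) = real_of_int ((int T - e) div int Q) - real_of_int ((- e) div int Q)"
    using eq by (metis of_int_diff of_int_of_nat_eq)
  moreover have "real_of_int (int T - e) / real Q - real_of_int (- e) / real Q = real T / real Q"
    by (simp add: diff_divide_distrib)
  ultimately show ?thesis using fl[of "int T - e"] fl[of "- e"] unfolding c_def by linarith
qed

text \<open>By the Chinese remainder theorem the two conditions amount to one class modulo
  \<open>D * r\<close>.\<close>

lemma card_dvd_cong_interval_bound: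
  fixes e :: int
  assumes "coprime D r" "D > 0" "r > 0"
  shows "\<bar>real (card {t \<in> {1..T}. [int t = e] (mod int r) \<and> D dvd t}) - real T / (real D * real r)\<bar> \<le> 1"
proof -
  have cop: "coprime (int D) (int r)" using assms by simp
  obtain f where f: "[f = 0] (mod int D)" "[f = e] (mod int r)"
    using binary_chinese_remainder_int[OF cop] by blast
  have "[int t = e] (mod int r) \<and> D dvd t \<longleftrightarrow> [int t = f] (mod int (D * r))" for t
  proof
    assume "[int t = e] (mod int r) \<and> D dvd t"
    then have "[int t = f] (mod int r)" "[int t = f] (mod int D)"
      using f by (metis cong_sym cong_trans, metis cong_0_iff cong_sym cong_trans of_nat_dvd_iff)
    then show "[int t = f] (mod int (D * r))"
      using coprime_cong_mult[OF _ _ cop] by simp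
  next
    assume *: "[int t = f] (mod int (D * r))"
    then have "[int t = f] (mod int r)" "[int t = f] (mod int D)"
      by (metis cong_dvd_modulus dvd_triv_left dvd_triv_right of_nat_mult)+
    then show "[int t = e] (mod int r) \<and> D dvd t"
      using f by (metis cong_0_iff cong_trans of_nat_dvd_iff)
  qed
  then show ?thesis using card_cong_interval_bound[of "D * r" T f] assms by simp
qed

text \<open>Agrees with the Moebius function on squarefree arguments; elsewhere it is a sign instead
  of 0, which makes its absolute value 1 throughout.\<close>

definition mobius :: "nat \<Rightarrow> real" where
  "mobius d = (\<Prod>p\<in>prime_factors d. - 1)"

lemma abs_mobius [simp]: "\<bar>mobius d\<bar> = 1"
  by (simp add: mobius_def power_abs)

lemma mobius_1 [simp]: "mobius 1 = 1" "mobius (Suc 0) = 1"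
  by (simp_all add: mobius_def)

lemma mobius_mult_coprime:
  assumes "coprime a b" "a > 0" "b > 0"
  shows "mobius (a * b) = mobius a * mobius b"
proof -
  have "prime_factors a \<inter> prime_factors b = {}"
  proof (intro equals0I)
    fix p assume "p \<in> prime_factors a \<inter> prime_factors b"
    then show False using coprime_common_divisor_nat[OF assms(1), of p] by (auto simp: in_prime_factors_iff)
  qed
  then show ?thesis
    using prime_factors_product[of a b] assms
    by (simp add: mobius_def prod.union_disjoint del: prod_constant)
qed

lemma sum_mobius_dvd:
  assumes "squarefree n"
  shows "(\<Sum>d | d dvd n. mobius d) = of_bool (n = 1)"
proof -
  have "n \<noteq> 0" using assms by (metis not_squarefree_0)
  then have "(\<Prod>p\<in>prime_factors n. 0) = (of_bool (n = 1) :: real)"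
    using prime_factorization_empty_iff[of n] by (cases "prime_factors n = {}") (auto simp: card_gt_0_iff)
  then show ?thesis
    using sum_dvd_squarefree_eq_prod[OF assms, of "\<lambda>_. - 1"]
    by (simp add: mobius_def del: prod_constant)
qed

text \<open>Moebius inversion over the multiples of \<open>k\<close>. With \<open>j = k * m\<close>
  each \<open>d\<close> is \<open>k * c\<close> for a divisor \<open>c\<close> of \<open>m\<close>;
  the sign factors, and the sum over \<open>c\<close> vanishes unless \<open>m = 1\<close>.\<close>

lemma sum_mobius_between:
  assumes "squarefree j" "k dvd j"
  shows "(\<Sum>d | k dvd d \<and> d dvd j. mobius d) = of_bool (j = k) * mobius k"
proof -
  obtain m where m: "j = k * m" using assms(2) by auto
  have "j \<noteq> 0" using assms(1) by (metis not_squarefree_0)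
  then have k0: "k > 0" and m0: "m > 0" using m by simp_all
  have cop: "coprime k m" using squarefree_mult_imp_coprime assms(1) unfolding m by blast
  have sqm: "squarefree m" using assms(1) squarefree_multD(2)[of k m] unfolding m by simp
  have "{d. k dvd d \<and> d dvd j} = (*) k ` {d. d dvd m}"
  proof (intro equalityI subsetI)
    fix d assume "d \<in> {d. k dvd d \<and> d dvd j}"
    then obtain c where c: "d = k * c" "d dvd j" by (metis dvdE mem_Collect_eq)
    then have "c dvd m" using k0 m by simp
    then show "d \<in> (*) k ` {d. d dvd m}" using c by blast
  qed (auto simp: m)
  then have "(\<Sum>d | k dvd d \<and> d dvd j. mobius d) = (\<Sum>d | d dvd m. mobius (k * d))"
    using k0 by (simp add: sum.reindex inj_on_def)
  also have "\<dots> = (\<Sum>d | d dvd m. mobius k * mobius d)"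
  proof (intro sum.cong refl mobius_mult_coprime k0)
    fix d assume d: "d \<in> {d. d dvd m}"
    then show "coprime k d" using cop coprime_divisors[of k k d m] by simp
    show "d > 0" using d m0 by (simp add: dvd_pos_nat)
  qed
  also have "\<dots> = mobius k * of_bool (m = 1)"
    using sum_mobius_dvd[OF sqm] by (simp add: sum_distrib_left[symmetric])
  also have "m = 1 \<longleftrightarrow> j = k" using k0 m by simp
  finally show ?thesis by (simp add: mult.commute)
qed

text \<open>The sieving moduli up to the level \<open>W\<close>. Primes dividing \<open>r\<close>
  are left out, since divisibility by them is constant on a residue class modulo
  \<open>r\<close>.\<close>

definition selberg_support :: "nat \<Rightarrow> nat \<Rightarrow> nat set" where
  "selberg_support r W = {k. 1 \<le> k \<and> k \<le> W \<and> squarefree k \<and> coprime k r}"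

definition selberg_mass :: "nat \<Rightarrow> nat \<Rightarrow> real" where
  "selberg_mass r W = (\<Sum>k\<in>selberg_support r W. 1 / real (totient k))"

lemma finite_selberg_support [simp]: "finite (selberg_support r W)"
  by (rule finite_subset[of _ "{..W}"]) (auto simp: selberg_support_def)

lemma selberg_support_dvd:
  assumes "k \<in> selberg_support r W" "d dvd k"
  shows "d \<in> selberg_support r W"
proof -
  have "d \<le> k" "d > 0" using assms dvd_imp_le[of d k] dvd_pos_nat[of k d] by (auto simp: selberg_support_def)
  moreover have "coprime d r" using assms coprime_divisors[of d k r r] by (auto simp: selberg_support_def)
  ultimately show ?thesis
    using assms squarefree_mono[of d k] by (auto simp: selberg_support_def)
qed

lemma one_in_selberg_support: "W \<ge> 1 \<Longrightarrow> 1 \<in> selberg_support r W"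
  by (simp add: selberg_support_def)

lemma selberg_mass_pos:
  assumes "W \<ge> 1"
  shows "selberg_mass r W > 0"
  unfolding selberg_mass_def
proof (rule sum_pos)
  show "selberg_support r W \<noteq> {}" using one_in_selberg_support[OF assms] by blast
qed (auto simp: selberg_support_def)

text \<open>Selberg's optimal weights in closed form: they minimise the quadratic form below among
  the weights on \<open>selberg_support r W\<close> with value 1 at 1.\<close>

definition selberg_weight :: "nat \<Rightarrow> nat \<Rightarrow> nat \<Rightarrow> real" where
  "selberg_weight r W d = mobius d * real d / selberg_mass r W *
     (\<Sum>k | k \<in> selberg_support r W \<and> d dvd k. 1 / real (totient k))"

lemma selberg_weight_1: "W \<ge> 1 \<Longrightarrow> selberg_weight r W 1 = 1"
  using selberg_mass_pos[of W r] by (simp add: selberg_weight_def selberg_mass_def)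

text \<open>The inner sum is part of the mass. So crude a bound suffices because the level will be a
  small power of \<open>x\<close>.\<close>

lemma abs_selberg_weight_le:
  assumes "W \<ge> 1"
  shows "\<bar>selberg_weight r W d\<bar> \<le> real d"
proof -
  have "(\<Sum>k | k \<in> selberg_support r W \<and> d dvd k. 1 / real (totient k)) \<le> selberg_mass r W"
    unfolding selberg_mass_def by (intro sum_mono2) auto
  then have "(\<Sum>k | k \<in> selberg_support r W \<and> d dvd k. 1 / real (totient k)) / selberg_mass r W \<le> 1"
    using selberg_mass_pos[OF assms, of r] by simp
  moreover have "\<bar>selberg_weight r W d\<bar> = real d *
    ((\<Sum>k | k \<in> selberg_support r W \<and> d dvd k. 1 / real (totient k)) / selberg_mass r W)"
    using selberg_mass_pos[OF assms, of r] unfolding selberg_weight_def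
    by (simp add: abs_mult sum_nonneg)
  ultimately show ?thesis by (metis mult.right_neutral mult_left_mono of_nat_0_le_iff)
qed

text \<open>Comparison with the harmonic sum: writing \<open>n = k * m\<^sup>2\<close> with
  \<open>k\<close> squarefree costs a factor 2 from the inverse squares, and pulling the gcd with
  \<open>r\<close> out of \<open>k\<close> costs the product over the primes of
  \<open>r\<close>.\<close>

lemma selberg_mass_ge:
  assumes "squarefree r" "W \<ge> 1"
  shows "ln (real W + 1) \<le> 2 * (\<Prod>p\<in>prime_factors r. 1 + 1 / real p) * selberg_mass r W"
proof -
  define K where "K = selberg_support r W"
  define B where "B = {k. 1 \<le> k \<and> k \<le> W \<and> squarefree k}"
  have r0: "r > 0" using assms(1) by (metis gr0I not_squarefree_0)
  have finB: "finite B" by (rule finite_subset[of _ "{..W}"]) (auto simp: B_def)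
  \<comment> \<open>Here \<open>n = d * k\<close> with \<open>d = gcd n r\<close>. A prime dividing
    both \<open>k\<close> and \<open>r\<close> would divide \<open>d\<close> as well, so its square
    would divide the squarefree \<open>n\<close>.\<close>
  have "(\<Sum>k\<in>B. 1 / real k) \<le> (\<Sum>n\<in>(\<lambda>(d, k). d * k) ` ({d. d dvd r} \<times> K). 1 / real n)"
  proof (intro sum_mono2)
    show "B \<subseteq> (\<lambda>(d, k). d * k) ` ({d. d dvd r} \<times> K)"
    proof
      fix n assume n: "n \<in> B"
      define d where "d = gcd n r"
      obtain k where k: "n = d * k" using gcd_dvd1[of n r] unfolding d_def by (rule dvdE)
      have sq: "squarefree k" "squarefree (d * k)" using n k squarefree_multD(2)[of d k] by (simp_all add: B_def)
      have n': "n > 0" "n \<le> W" using n by (auto simp: B_def)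
      have "k dvd n" using k by simp
      then have "k \<le> n" "k > 0" using n'(1) by (auto intro: dvd_imp_le dvd_pos_nat)
      then have k1: "k \<ge> 1" "k \<le> W" using n'(2) by simp_all
      have "coprime k r"
      proof (rule ccontr)
        assume "\<not> coprime k r"
        then have "gcd k r \<noteq> 1" by (simp only: coprime_iff_gcd_eq_1 not_False_eq_True)
        then obtain p where "prime p" "p dvd gcd k r" by (metis prime_factor_nat)
        then have p: "prime p" "p dvd k" "p dvd r" by simp_all
        then have "p dvd d" unfolding d_def using k by (intro gcd_greatest) simp_all
        then have "p\<^sup>2 dvd d * k" unfolding power2_eq_square using p by (intro mult_dvd_mono)
        then show False using squarefreeD[OF sq(2), of p] p(1) by simp
      qed
      then have "k \<in> K" using sq k1 by (simp add: K_def selberg_support_def)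
      moreover have "d dvd r" unfolding d_def by simp
      ultimately show "n \<in> (\<lambda>(d, k). d * k) ` ({d. d dvd r} \<times> K)"
        using k by (intro image_eqI[of _ _ "(d, k)"]) simp_all
    qed
  qed (use r0 in \<open>simp_all add: K_def\<close>)
  also have "\<dots> \<le> (\<Sum>x\<in>{d. d dvd r} \<times> K. 1 / real ((\<lambda>(d, k). d * k) x))"
    using sum_image_le[of "{d. d dvd r} \<times> K" "\<lambda>n. 1 / real n" "\<lambda>(d, k). d * k"] r0
    by (simp add: o_def K_def)
  also have "\<dots> = (\<Sum>(d, k)\<in>{d. d dvd r} \<times> K. 1 / real d * (1 / real k))"
    by (intro sum.cong) auto
  also have "\<dots> = (\<Sum>d | d dvd r. 1 / real d) * (\<Sum>k\<in>K. 1 / real k)"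
    unfolding sum_product by (rule sum.cartesian_product[symmetric])
  finally have B: "(\<Sum>k\<in>B. 1 / real k) \<le> (\<Sum>d | d dvd r. 1 / real d) * (\<Sum>k\<in>K. 1 / real k)" .
  have "(\<Sum>d | d dvd r. 1 / real d) = (\<Sum>d | d dvd r. \<Prod>p\<in>prime_factors d. 1 / real p)"
  proof (intro sum.cong refl)
    fix d assume "d \<in> {d. d dvd r}"
    then have "squarefree d" using squarefree_mono[OF _ assms(1)] by simp
    then have "real d = real (\<Prod>(prime_factors d))"
      by (simp only: prod_prime_factors_squarefree)
    also have "\<dots> = (\<Prod>p\<in>prime_factors d. real p)" by (rule of_nat_prod)
    finally have "1 / real d = 1 / (\<Prod>p\<in>prime_factors d. real p)" by (simp only:)
    also have "\<dots> = (\<Prod>p\<in>prime_factors d. 1 / real p)" by (simp add: prod_dividef)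
    finally show "1 / real d = (\<Prod>p\<in>prime_factors d. 1 / real p)" .
  qed
  also have "\<dots> = (\<Prod>p\<in>prime_factors r. 1 + 1 / real p)"
    by (rule sum_dvd_squarefree_eq_prod[OF assms(1)])
  finally have "(\<Sum>k\<in>B. 1 / real k) \<le> (\<Prod>p\<in>prime_factors r. 1 + 1 / real p) * (\<Sum>k\<in>K. 1 / real k)"
    using B by simp
  also have "\<dots> \<le>
      (\<Prod>p\<in>prime_factors r. 1 + 1 / real p) * selberg_mass r W"
  proof (intro mult_left_mono prod_nonneg)
    show "(\<Sum>k\<in>K. 1 / real k) \<le> selberg_mass r W"
      unfolding selberg_mass_def K_def
      by (intro sum_mono divide_left_mono) (auto simp: selberg_support_def totient_le)
  qed auto
  finally have B: "(\<Sum>k\<in>B. 1 / real k) \<le> (\<Prod>p\<in>prime_factors r. 1 + 1 / real p) * selberg_mass r W" .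
  have "ln (real W + 1) \<le> harm W" by (rule ln_le_harm)
  also have "harm W = (\<Sum>n\<in>{1..W}. 1 / real n)" by (simp add: harm_def inverse_eq_divide)
  \<comment> \<open>Every \<open>n\<close> is its squarefree part times the square of
    \<open>square_part n\<close>, and both of these are divisors of \<open>n\<close>, hence at most
    \<open>W\<close>.\<close>
  also have "\<dots> \<le> (\<Sum>n\<in>(\<lambda>(k, m). k * m\<^sup>2) ` (B \<times> {1..W}). 1 / real n)"
  proof (intro sum_mono2)
    show "{1..W} \<subseteq> (\<lambda>(k, m). k * m\<^sup>2) ` (B \<times> {1..W})"
    proof
      fix n assume n: "n \<in> {1..W}"
      let ?k = "squarefree_part n" and ?m = "square_part n"
      have pos: "?k > 0" "?m > 0"
        using n by (simp_all add: neq0_conv[symmetric] del: neq0_conv)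
      have "?k dvd ?k * ?m\<^sup>2" by simp
      then have "?k dvd n" by (simp only: squarefree_decompose[symmetric])
      moreover have "?m dvd ?m\<^sup>2" by simp
      then have "?m dvd n" using square_part_square_dvd[of n] by (rule dvd_trans)
      ultimately have "?k \<le> W" "?m \<le> W"
        using n dvd_imp_le[of ?k n] dvd_imp_le[of ?m n] by simp_all
      then have "(?k, ?m) \<in> B \<times> {1..W}" using pos by (simp add: B_def)
      moreover have "n = (\<lambda>(k, m). k * m\<^sup>2) (?k, ?m)"
        unfolding case_prod_conv by (rule squarefree_decompose)
      ultimately show "n \<in> (\<lambda>(k, m). k * m\<^sup>2) ` (B \<times> {1..W})"
        by (rule image_eqI[rotated])
    qed
  qed (use finB in simp_all)
  also have "\<dots> \<le> (\<Sum>x\<in>B \<times> {1..W}. 1 / real ((\<lambda>(k, m). k * m\<^sup>2) x))"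
    using sum_image_le[of "B \<times> {1..W}" "\<lambda>n. 1 / real n" "\<lambda>(k, m). k * m\<^sup>2"] finB by (simp add: o_def)
  also have "\<dots> = (\<Sum>(k, m)\<in>B \<times> {1..W}. 1 / real k * (1 / (real m)\<^sup>2))"
    by (intro sum.cong) auto
  also have "\<dots> = (\<Sum>k\<in>B. 1 / real k) * (\<Sum>m=1..W. 1 / (real m)\<^sup>2)"
    unfolding sum_product by (rule sum.cartesian_product[symmetric])
  also have "\<dots> \<le> (\<Sum>k\<in>B. 1 / real k) * 2"
    by (intro mult_left_mono sum_inverse_squares_le sum_nonneg) auto
  also have "\<dots> \<le> (\<Prod>p\<in>prime_factors r. 1 + 1 / real p) * selberg_mass r W * 2"
    using B by (intro mult_right_mono) simp_all
  finally show ?thesis by (simp add: mult_ac)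
qed

text \<open>Replacing the lcm by the gcd and expanding the gcd into totients diagonalises the form
  into the sum of \<open>real (totient k) * (y k)\<^sup>2\<close>. For Selberg's weights
  \<open>y k\<close> is \<open>mobius k / (?L * real (totient k))\<close>, so the diagonal sum is
  \<open>?L / ?L\<^sup>2\<close>.\<close>

lemma selberg_quadratic_form:
  fixes r W :: nat
  assumes "W \<ge> 1"
  defines "K \<equiv> selberg_support r W" and "u \<equiv> selberg_weight r W"
  shows "(\<Sum>d1\<in>K. \<Sum>d2\<in>K. u d1 * u d2 / real (lcm d1 d2)) = 1 / selberg_mass r W"
proof -
  let ?L = "selberg_mass r W"
  have L: "?L > 0" using selberg_mass_pos[OF assms(1)] .
  have fin: "finite K" unfolding K_def by simp
  have K: "d > 0" "squarefree d" if "d \<in> K" for d using that by (auto simp: K_def selberg_support_def)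
  define y where "y k = (\<Sum>d\<in>K. of_bool (k dvd d) * (u d / real d))" for k
  \<comment> \<open>The totients of the divisors of a number sum to that number. Divisors of members
    of \<open>K\<close> are again in \<open>K\<close>, so the sum may run over
    \<open>K\<close>.\<close>
  have gcd_sum: "real (gcd d1 d2) = (\<Sum>k\<in>K. of_bool (k dvd d1) * of_bool (k dvd d2) * real (totient k))"
    if "d1 \<in> K" "d2 \<in> K" for d1 d2
  proof -
    have "real (gcd d1 d2) = real (\<Sum>k | k dvd gcd d1 d2. totient k)"
      by (simp only: totient_divisor_sum)
    also have "\<dots> = (\<Sum>k | k dvd gcd d1 d2. real (totient k))" by simp
    also have "\<dots> = (\<Sum>k\<in>K. if k dvd gcd d1 d2 then real (totient k) else 0)"
      using selberg_support_dvd that fin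
      by (subst sum.inter_filter[symmetric]) (auto simp: K_def intro!: sum.cong)
    also have "\<dots> = (\<Sum>k\<in>K. of_bool (k dvd d1) * of_bool (k dvd d2) * real (totient k))"
      by (intro sum.cong) auto
    finally show ?thesis .
  qed
  have "(\<Sum>d1\<in>K. \<Sum>d2\<in>K. u d1 * u d2 / real (lcm d1 d2)) =
        (\<Sum>d1\<in>K. \<Sum>d2\<in>K. (u d1 / real d1) * (u d2 / real d2) * real (gcd d1 d2))"
  proof (intro sum.cong refl)
    fix d1 d2 assume d: "d1 \<in> K" "d2 \<in> K"
    have "real (lcm d1 d2) * real (gcd d1 d2) = real d1 * real d2"
      using prod_gcd_lcm_nat[of d1 d2] by (metis mult.commute of_nat_mult)
    moreover have "real (lcm d1 d2) > 0" using K(1)[OF d(1)] K(1)[OF d(2)] by (simp add: lcm_pos_nat)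
    ultimately show "u d1 * u d2 / real (lcm d1 d2) = (u d1 / real d1) * (u d2 / real d2) * real (gcd d1 d2)"
      using K(1)[OF d(1)] K(1)[OF d(2)] by (simp add: field_simps)
  qed
  also have "\<dots> = (\<Sum>d1\<in>K. \<Sum>d2\<in>K. \<Sum>k\<in>K. real (totient k) *
      (of_bool (k dvd d1) * (u d1 / real d1)) * (of_bool (k dvd d2) * (u d2 / real d2)))"
    by (intro sum.cong refl) (simp add: gcd_sum sum_distrib_left mult_ac)
  also have "\<dots> = (\<Sum>d1\<in>K. \<Sum>k\<in>K. \<Sum>d2\<in>K. real (totient k) *
      (of_bool (k dvd d1) * (u d1 / real d1)) * (of_bool (k dvd d2) * (u d2 / real d2)))"
    by (rule sum.cong[OF refl], rule sum.swap)
  also have "\<dots> = (\<Sum>k\<in>K. \<Sum>d1\<in>K. \<Sum>d2\<in>K. real (totient k) *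
      (of_bool (k dvd d1) * (u d1 / real d1)) * (of_bool (k dvd d2) * (u d2 / real d2)))"
    by (rule sum.swap)
  also have "\<dots> = (\<Sum>k\<in>K. real (totient k) * (y k)\<^sup>2)"
    unfolding y_def power2_eq_square sum_product
    by (simp only: sum_distrib_left mult.assoc)
  also have "\<dots> = (\<Sum>k\<in>K. 1 / ?L\<^sup>2 * (1 / real (totient k)))"
  proof (intro sum.cong refl)
    fix k assume k: "k \<in> K"
    have "y k = (\<Sum>d\<in>K. \<Sum>j\<in>K. of_bool (k dvd d \<and> d dvd j) * mobius d / ?L * (1 / real (totient j)))"
      unfolding y_def
    proof (intro sum.cong refl)
      fix d assume d: "d \<in> K"
      have "u d / real d = mobius d / ?L * (\<Sum>j\<in>K. if d dvd j then 1 / real (totient j) else 0)"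
        unfolding u_def selberg_weight_def using K(1)[OF d]
        by (subst sum.inter_filter[symmetric]) (auto simp: K_def)
      then show "of_bool (k dvd d) * (u d / real d) =
          (\<Sum>j\<in>K. of_bool (k dvd d \<and> d dvd j) * mobius d / ?L * (1 / real (totient j)))"
        by (auto simp: sum_distrib_left intro!: sum.cong)
    qed
    \<comment> \<open>The weights make \<open>y\<close> a double sum; once the sums are exchanged,
      Moebius inversion leaves only \<open>j = k\<close>.\<close>
    also have "\<dots> = (\<Sum>j\<in>K. 1 / (?L * real (totient j)) * (\<Sum>d\<in>K. of_bool (k dvd d \<and> d dvd j) * mobius d))"
      by (subst sum.swap) (simp add: sum_distrib_left mult_ac)
    also have "\<dots> = (\<Sum>j\<in>K. 1 / (?L * real (totient j)) * (of_bool (j = k) * mobius k))"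
    proof (intro sum.cong refl arg_cong2[where f = "(*)"])
      fix j assume j: "j \<in> K"
      have "(\<Sum>d\<in>K. of_bool (k dvd d \<and> d dvd j) * mobius d) =
            (\<Sum>d\<in>K. if k dvd d \<and> d dvd j then mobius d else 0)"
        by (intro sum.cong) auto
      also have "\<dots> = (\<Sum>d | k dvd d \<and> d dvd j. mobius d)"
        using selberg_support_dvd j fin
        by (subst sum.inter_filter[symmetric]) (auto simp: K_def intro!: sum.cong)
      also have "\<dots> = of_bool (j = k) * mobius k"
      proof (cases "k dvd j")
        case True
        then show ?thesis using sum_mobius_between K(2)[OF j] by blast
      next
        case False
        then have *: "{d. k dvd d \<and> d dvd j} = {}" using dvd_trans by blast
        show ?thesis unfolding * using False by auto
      qed
      finally show "(\<Sum>d\<in>K. of_bool (k dvd d \<and> d dvd j) * mobius d) = of_bool (j = k) * mobius k" .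
    qed
    also have "\<dots> = (\<Sum>j\<in>K. if j = k then mobius k / (?L * real (totient k)) else 0)"
      by (intro sum.cong) auto
    also have "\<dots> = mobius k / (?L * real (totient k))" using k fin by simp
    finally have "y k = mobius k / (?L * real (totient k))" .
    moreover have "(mobius k)\<^sup>2 = 1" by (metis abs_mobius one_power2 power2_abs)
    ultimately show "real (totient k) * (y k)\<^sup>2 = 1 / ?L\<^sup>2 * (1 / real (totient k))"
      using K(1)[OF k] by (simp add: power_divide power_mult_distrib power2_eq_square field_simps)
  qed
  also have "\<dots> = 1 / ?L\<^sup>2 * ?L"
    by (simp add: sum_distrib_left selberg_mass_def K_def)
  also have "\<dots> = 1 / ?L" using L by (simp add: power2_eq_square)
  finally show ?thesis .
qed

text \<open>If \<open>t\<close> has no prime up to \<open>W\<close>, only \<open>d = 1\<close>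
  contributes to the divisor sum of the weights, so its square is 1; for other \<open>t\<close> the
  square is at least 0. Expanding it, the densities of the lcm's give the quadratic form, and each
  of the at most \<open>W * W\<close> pairs has an error of at most \<open>W * W\<close>.\<close>

theorem selberg_sieve_arithmetic_progression:
  fixes e :: int
  assumes "r > 0" "W \<ge> 1"
  shows "real (card {t \<in> {1..T}. [int t = e] (mod int r) \<and> (\<forall>p. prime p \<longrightarrow> p dvd t \<longrightarrow> p > W)})
         \<le> real T / (real r * selberg_mass r W) + real W ^ 4"
proof -
  define K where "K = selberg_support r W"
  define u where "u = selberg_weight r W"
  define N where "N = {t \<in> {1..T}. [int t = e] (mod int r)}"
  let ?S = "{t \<in> {1..T}. [int t = e] (mod int r) \<and> (\<forall>p. prime p \<longrightarrow> p dvd t \<longrightarrow> p > W)}"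
  have fin: "finite K" "finite N" unfolding K_def N_def by simp_all
  have "real (card ?S) = (\<Sum>t\<in>?S. 1)" by simp
  also have "\<dots> = (\<Sum>t\<in>?S. (\<Sum>d\<in>K. of_bool (d dvd t) * u d)\<^sup>2)"
  proof (intro sum.cong refl)
    fix t assume t: "t \<in> ?S"
    have "\<not> d dvd t" if d: "d \<in> K" "d \<noteq> 1" for d
    proof
      assume dt: "d dvd t"
      obtain p where p: "prime p" "p dvd d" using d(2) prime_factor_nat by blast
      have "p \<le> W" using p d dvd_imp_le[of p d] by (auto simp: K_def selberg_support_def)
      moreover have "p > W" using t p(1) dvd_trans[OF p(2) dt] by simp
      ultimately show False by simp
    qed
    then have "(\<Sum>d\<in>K. of_bool (d dvd t) * u d) = (\<Sum>d\<in>K. if d = 1 then u 1 else 0)"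
      by (intro sum.cong) auto
    also have "\<dots> = 1"
      using fin one_in_selberg_support[OF assms(2)] selberg_weight_1[OF assms(2)]
      by (simp add: K_def u_def)
    finally show "1 = (\<Sum>d\<in>K. of_bool (d dvd t) * u d)\<^sup>2" by simp
  qed
  also have "\<dots> \<le> (\<Sum>t\<in>N. (\<Sum>d\<in>K. of_bool (d dvd t) * u d)\<^sup>2)"
    by (intro sum_mono2) (auto simp: N_def)
  also have "\<dots> = (\<Sum>t\<in>N. \<Sum>d1\<in>K. \<Sum>d2\<in>K. u d1 * u d2 * of_bool (lcm d1 d2 dvd t))"
    unfolding power2_eq_square sum_product by (intro sum.cong refl) (auto simp: of_bool_conj)
  also have "\<dots> = (\<Sum>d1\<in>K. \<Sum>d2\<in>K. u d1 * u d2 * (\<Sum>t\<in>N. of_bool (lcm d1 d2 dvd t)))"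
    by (subst sum.swap, rule sum.cong[OF refl], subst sum.swap) (simp add: sum_distrib_left)
  also have "\<dots> \<le> (\<Sum>d1\<in>K. \<Sum>d2\<in>K. u d1 * u d2 * (real T / (real (lcm d1 d2) * real r)) + real W * real W)"
  proof (intro sum_mono)
    fix d1 d2 assume d: "d1 \<in> K" "d2 \<in> K"
    let ?D = "lcm d1 d2"
    have "coprime (d1 * d2) r" "?D dvd d1 * d2"
      using d by (auto simp: K_def selberg_support_def)
    then have cop: "coprime ?D r" using coprime_divisors[OF _ dvd_refl, of ?D "d1 * d2" r] by simp
    have D0: "?D > 0" using d by (intro lcm_pos_nat) (auto simp: K_def selberg_support_def)
    have "(\<Sum>t\<in>N. of_bool (?D dvd t)) = real (card {t \<in> {1..T}. [int t = e] (mod int r) \<and> ?D dvd t})"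
      (is "?c = _") using fin by (simp add: sum_of_bool_eq N_def conj_ac Int_def)
    then have err: "\<bar>?c - real T / (real ?D * real r)\<bar> \<le> 1"
      using card_dvd_cong_interval_bound[OF cop D0 assms(1), of T e] by simp
    have uW: "\<bar>u d\<bar> \<le> real W" if "d \<in> K" for d
      using abs_selberg_weight_le[OF assms(2), of r d] that unfolding u_def K_def selberg_support_def
      by (auto intro: order_trans)
    have "u d1 * u d2 * (?c - real T / (real ?D * real r)) \<le>
        \<bar>u d1\<bar> * \<bar>u d2\<bar> * \<bar>?c - real T / (real ?D * real r)\<bar>"
      by (metis abs_ge_self abs_mult)
    also have "\<dots> \<le> real W * real W * 1"
      using err uW[OF d(1)] uW[OF d(2)] by (intro mult_mono) auto
    finally show "u d1 * u d2 * ?c \<le> u d1 * u d2 * (real T / (real ?D * real r)) + real W * real W"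
      by (simp add: algebra_simps)
  qed
  also have "\<dots> = real T / real r * (\<Sum>d1\<in>K. \<Sum>d2\<in>K. u d1 * u d2 / real (lcm d1 d2)) +
      real (card K) * real (card K) * (real W * real W)"
    by (simp add: sum.distrib sum_distrib_left mult_ac)
  also have "\<dots> \<le> real T / real r * (1 / selberg_mass r W) + real W * real W * (real W * real W)"
  proof (intro add_mono)
    have "card K \<le> card {1..W}" by (rule card_mono) (auto simp: K_def selberg_support_def)
    then have "real (card K) \<le> real W" by simp
    then show "real (card K) * real (card K) * (real W * real W) \<le> real W * real W * (real W * real W)"
      by (intro mult_right_mono mult_mono) simp_all
    show "real T / real r * (\<Sum>d1\<in>K. \<Sum>d2\<in>K. u d1 * u d2 / real (lcm d1 d2)) \<le>
       real T / real r * (1 / selberg_mass r W)"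
      using selberg_quadratic_form[OF assms(2), of r] by (simp add: K_def u_def)
  qed
  also have "\<dots> = real T / (real r * selberg_mass r W) + real W ^ 4"
    by (simp add: power4_eq_xxxx)
  finally show ?thesis .
qed

section \<open>Twisted multiplicativity\<close>

text \<open>Representatives start at 0, so that modulus 1 has exactly the class of 0.\<close>

definition reduced_residues :: "nat \<Rightarrow> int set" where
  "reduced_residues r = {c. 0 \<le> c \<and> c < int r \<and> coprime c (int r)}"

lemma finite_reduced_residues [simp]: "finite (reduced_residues r)"
  by (rule finite_subset[of _ "{0..int r}"]) (auto simp: reduced_residues_def)

lemma mod_in_reduced_residues:
  assumes "r > 0" "coprime c (int r)"
  shows "c mod int r \<in> reduced_residues r"
  using assms by (simp add: reduced_residues_def)

lemma reduced_residues_prime: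
  assumes "prime p"
  shows "reduced_residues p = int ` totatives p"
proof (intro equalityI subsetI)
  fix c assume c: "c \<in> reduced_residues p"
  then have "c \<noteq> 0" using prime_gt_1_nat[OF assms] by (auto simp: reduced_residues_def)
  then have "nat c \<in> totatives p" "c = int (nat c)"
    using c by (auto simp: reduced_residues_def in_totatives_iff coprime_int_iff[symmetric] simp del: coprime_int_iff)
  then show "c \<in> int ` totatives p" by blast
next
  fix c assume "c \<in> int ` totatives p"
  then obtain x where x: "c = int x" "x \<in> totatives p" by blast
  then have "x < p" using totatives_less prime_gt_1_nat[OF assms] by blast
  then show "c \<in> reduced_residues p" using x by (simp add: reduced_residues_def in_totatives_iff)
qed

text \<open>Not divided by the modulus, so at a prime it is bounded by
  \<open>real p * g p\<close>.\<close>

definition residue_norm :: "(int \<Rightarrow> nat \<Rightarrow> complex) \<Rightarrow> nat \<Rightarrow> real" where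
  "residue_norm V r = (\<Sum>c\<in>reduced_residues r. cmod (V c r))"

lemma residue_norm_nonneg: "residue_norm V r \<ge> 0"
  by (simp add: residue_norm_def sum_nonneg)

context
  fixes V :: "int \<Rightarrow> nat \<Rightarrow> complex"
  assumes tw: "twisted_multiplicative V"
begin

lemma twisted_periodic: "[a = b] (mod int q) \<Longrightarrow> V a q = V b q"
  using tw unfolding twisted_multiplicative_def by blast

lemma twisted_mod: "V (a mod int q) q = V a q"
  by (rule twisted_periodic) (simp add: cong_def)

lemma twisted_mult:
  assumes "squarefree (q1 * q2)" "coprime a (int (q1 * q2))"
    "[int q1 * b1 = 1] (mod int q2)" "[int q2 * b2 = 1] (mod int q1)"
  shows "V a (q1 * q2) = V (a * b1) q2 * V (a * b2) q1"
  using tw squarefree_mult_imp_coprime[OF assms(1)] assms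
  unfolding twisted_multiplicative_def by blast

lemma twisted_eq_0: "\<not> squarefree q \<or> \<not> coprime a (int q) \<Longrightarrow> V a q = 0"
  using tw unfolding twisted_multiplicative_def by blast

text \<open>With both factors equal to 1 the relation says that \<open>V a 1\<close> is its own
  square.\<close>

lemma twisted_cmod_1: "cmod (V a 1) \<le> 1"
proof -
  have "V a (1 * 1) = V (a * 1) 1 * V (a * 1) 1"
    by (rule twisted_mult) (auto simp: cong_def)
  then have "V a 1 = 0 \<or> V a 1 = 1" by auto
  then show ?thesis by auto
qed

section \<open>Bounds built up one prime at a time\<close>

lemma inverses_exist:
  assumes "coprime q1 q2"
  obtains b1 b2 where "[int q1 * b1 = 1] (mod int q2)" "[int q2 * b2 = 1] (mod int q1)"
proof -
  have "coprime (int q1) (int q2)" "coprime (int q2) (int q1)"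
    using assms by (simp_all add: coprime_commute)
  then show ?thesis using cong_solve_coprime_int that by metis
qed

text \<open>Splitting off a prime twists the residue at both factors, so the induction and the bound
  at primes range over all residues.\<close>

lemma twisted_cmod_le_power:
  assumes "B \<ge> 1" "\<And>a p. prime p \<Longrightarrow> cmod (V a p) \<le> B"
  shows "cmod (V a q) \<le> B ^ card (prime_factors q)"
proof (induction q arbitrary: a rule: less_induct)
  case (less q)
  consider "V a q = 0" | "q = 1" | "squarefree q" "coprime a (int q)" "q \<noteq> 1"
    using twisted_eq_0 by blast
  then show ?case
  proof cases
    case 1
    then show ?thesis using assms(1) by simp
  next
    case 2
    then show ?thesis using twisted_cmod_1 by simp
  next
    case 3
    obtain p where p: "prime p" "p dvd q" using prime_factor_nat[OF 3(3)] by blast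
    obtain m where m: "q = p * m" using p(2) by (rule dvdE)
    have "q \<noteq> 0" using 3(1) by (metis not_squarefree_0)
    then have m0: "m \<noteq> 0" using m by simp
    have "m < q" using m m0 prime_gt_1_nat[OF p(1)] by simp
    have cop: "coprime p m" using squarefree_mult_imp_coprime 3(1) m by simp
    obtain b1 b2 where b: "[int p * b1 = 1] (mod int m)" "[int m * b2 = 1] (mod int p)"
      using inverses_exist[OF cop] by blast
    have "V a q = V (a * b1) m * V (a * b2) p"
      unfolding m using 3 b unfolding m by (intro twisted_mult)
    then have "cmod (V a q) \<le> B ^ card (prime_factors m) * B"
      using less.IH[OF \<open>m < q\<close>, of "a * b1"] assms(2)[OF p(1), of "a * b2"] assms(1)
      by (simp only: norm_mult) (rule mult_mono, simp_all)
    also have "\<dots> = B ^ card (prime_factors q)"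
    proof -
      have "prime_factors q = insert p (prime_factors m)"
        using prime_factors_product[of p m] m0 p(1) by (auto simp: m prime_prime_factors)
      moreover have "p \<notin> prime_factors m"
        using cop p(1) by (auto simp: in_prime_factors_iff prime_imp_coprime_nat dest: coprime_common_divisor_nat)
      ultimately show ?thesis by simp
    qed
    finally show ?thesis .
  qed
qed

text \<open>By the Chinese remainder theorem the two twisted residues determine the residue modulo
  \<open>q1 q2\<close>.\<close>

lemma residue_norm_mult_le:
  assumes sq: "squarefree (q1 * q2)"
  shows "residue_norm V (q1 * q2) \<le> residue_norm V q2 * residue_norm V q1"
proof -
  have cop: "coprime q1 q2" by (rule squarefree_mult_imp_coprime[OF sq])
  have "q1 * q2 \<noteq> 0" using sq by (metis not_squarefree_0)
  then have pos: "q1 > 0" "q2 > 0" by simp_all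
  obtain b1 b2 where b: "[int q1 * b1 = 1] (mod int q2)" "[int q2 * b2 = 1] (mod int q1)"
    using inverses_exist[OF cop] by blast
  have cb: "coprime b1 (int q2)" "coprime b2 (int q1)"
    using b by (metis coprime_iff_invertible_int mult.commute)+
  define f where "f c = ((c * b1) mod int q2, (c * b2) mod int q1)" for c
  have inj: "inj_on f (reduced_residues (q1 * q2))"
  proof (rule inj_onI)
    fix c d assume c: "c \<in> reduced_residues (q1 * q2)" and d: "d \<in> reduced_residues (q1 * q2)"
      and "f c = f d"
    then have "[c * b1 = d * b1] (mod int q2)" "[c * b2 = d * b2] (mod int q1)"
      by (simp_all add: f_def cong_def)
    then have "[c = d] (mod int q2)" "[c = d] (mod int q1)"
      using cb cong_mult_rcancel by blast+
    then have "[c = d] (mod int q1 * int q2)"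
      using cop by (intro coprime_cong_mult) simp_all
    then show "c = d"
      using c d by (intro cong_less_imp_eq_int[of c "int q1 * int q2" d]) (simp_all add: reduced_residues_def)
  qed
  have im: "f ` reduced_residues (q1 * q2) \<subseteq> reduced_residues q2 \<times> reduced_residues q1"
  proof
    fix x assume "x \<in> f ` reduced_residues (q1 * q2)"
    then obtain c where c: "c \<in> reduced_residues (q1 * q2)" and x: "x = f c" by blast
    have "coprime (c * b1) (int q2)" "coprime (c * b2) (int q1)"
      using c cb by (simp_all add: reduced_residues_def)
    then show "x \<in> reduced_residues q2 \<times> reduced_residues q1"
      unfolding x f_def using mod_in_reduced_residues pos by simp
  qed
  have "residue_norm V (q1 * q2) =
      (\<Sum>c\<in>reduced_residues (q1 * q2). (\<lambda>(x, y). cmod (V x q2) * cmod (V y q1)) (f c))"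
    unfolding residue_norm_def
  proof (intro sum.cong refl)
    fix c assume "c \<in> reduced_residues (q1 * q2)"
    then have "coprime c (int (q1 * q2))" by (simp add: reduced_residues_def)
    from twisted_mult[OF sq this b]
    show "cmod (V c (q1 * q2)) = (\<lambda>(x, y). cmod (V x q2) * cmod (V y q1)) (f c)"
      by (simp add: f_def twisted_mod norm_mult)
  qed
  also have "\<dots> = (\<Sum>(x, y)\<in>f ` reduced_residues (q1 * q2). cmod (V x q2) * cmod (V y q1))"
    by (simp add: sum.reindex[OF inj])
  also have "\<dots> \<le> (\<Sum>(x, y)\<in>reduced_residues q2 \<times> reduced_residues q1. cmod (V x q2) * cmod (V y q1))"
    using im by (intro sum_mono2) auto
  also have "\<dots> = residue_norm V q2 * residue_norm V q1"
    unfolding residue_norm_def sum_product by (rule sum.cartesian_product[symmetric])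
  finally show ?thesis .
qed

text \<open>Submultiplicativity, one prime at a time. That \<open>h\<close> is nonnegative at primes
  follows from the same property of \<open>residue_norm\<close>.\<close>

lemma residue_norm_le_prod:
  assumes "\<And>p. prime p \<Longrightarrow> residue_norm V p \<le> h p"
  shows "squarefree q \<Longrightarrow> residue_norm V q \<le> (\<Prod>p\<in>prime_factors q. h p)"
proof (induction q rule: less_induct)
  case (less q)
  show ?case
  proof (cases "q = 1")
    case True
    have "reduced_residues 1 = {0}" by (auto simp: reduced_residues_def)
    then show ?thesis using True twisted_cmod_1[of 0] by (simp add: residue_norm_def)
  next
    case False
    obtain p where p: "prime p" "p dvd q" using prime_factor_nat[OF False] by blast
    obtain m where m: "q = p * m" using p(2) by (rule dvdE)
    have "q \<noteq> 0" using less.prems by (metis not_squarefree_0)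
    then have m0: "m \<noteq> 0" using m by simp
    have "m < q" using m m0 prime_gt_1_nat[OF p(1)] by simp
    have cop: "coprime p m" using squarefree_mult_imp_coprime less.prems m by simp
    have sqm: "squarefree m" using squarefree_multD(2)[of p m] less.prems m by simp
    have pm: "p \<notin> prime_factors m"
      using cop p(1) by (auto simp: in_prime_factors_iff prime_imp_coprime_nat dest: coprime_common_divisor_nat)
    have hp: "h p \<ge> 0" using assms[OF p(1)] residue_norm_nonneg[of V p] by linarith
    have "residue_norm V q \<le> residue_norm V m * residue_norm V p"
      unfolding m using less.prems unfolding m by (rule residue_norm_mult_le)
    also have "\<dots> \<le> (\<Prod>p\<in>prime_factors m. h p) * h p"
    proof (rule mult_mono)
      show "0 \<le> prod h (prime_factors m)"
        using less.IH[OF \<open>m < q\<close> sqm] residue_norm_nonneg[of V m] by linarith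
    qed (use less.IH[OF \<open>m < q\<close> sqm] assms[OF p(1)] residue_norm_nonneg in simp_all)
    also have "\<dots> = (\<Prod>p\<in>prime_factors q. h p)"
    proof -
      have "prime_factors q = insert p (prime_factors m)"
        using prime_factors_product[of p m] m0 p(1) by (auto simp: m prime_prime_factors)
      then show ?thesis using pm by (simp add: mult.commute)
    qed
    finally show ?thesis .
  qed
qed

text \<open>In \<open>V a (r * t)\<close> the factor at \<open>t\<close> is at most
  \<open>Bv\<close>, and the factor at \<open>r\<close> is \<open>V c r\<close>, where
  \<open>c\<close> is \<open>a\<close> times the inverse of \<open>t\<close> modulo
  \<open>r\<close>. Fixing \<open>c\<close> fixes the class of \<open>t\<close>, so each
  \<open>c\<close> arises from at most \<open>N\<close> values of \<open>t\<close>.\<close>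

lemma sum_twisted_cofactors_le:
  assumes "finite S" "r > 0" "Bv \<ge> 0"
    and S: "\<And>t. t \<in> S \<Longrightarrow> squarefree (r * t) \<and> coprime a (int (r * t))"
    and Bv: "\<And>t c. t \<in> S \<Longrightarrow> cmod (V c t) \<le> Bv"
    and N: "\<And>e. real (card {t \<in> S. [int t = e] (mod int r)}) \<le> N"
  shows "(\<Sum>t\<in>S. cmod (V a (r * t))) \<le> Bv * N * residue_norm V r"
proof -
  have "\<exists>c. t \<in> S \<longrightarrow> c \<in> reduced_residues r \<and> [c * int t = a] (mod int r) \<and>
          cmod (V a (r * t)) \<le> Bv * cmod (V c r)" for t
  proof (cases "t \<in> S")
    case True
    have cop: "coprime r t" using S[OF True] squarefree_mult_imp_coprime by simp
    obtain b1 b2 where b: "[int r * b1 = 1] (mod int t)" "[int t * b2 = 1] (mod int r)"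
      using inverses_exist[OF cop] by blast
    have cb: "coprime b2 (int r)" using b(2) by (metis coprime_iff_invertible_int mult.commute)
    have "coprime a (int r)" using S[OF True] by simp
    then have "coprime (a * b2) (int r)" using cb by simp
    then have "(a * b2) mod int r \<in> reduced_residues r" by (rule mod_in_reduced_residues[OF assms(2)])
    moreover have "a * (int t * b2) = a * b2 * int t" by (simp add: mult_ac)
    then have "[(a * b2) mod int r * int t = a * (int t * b2)] (mod int r)"
      unfolding cong_def by (simp only: mod_mult_left_eq)
    then have "[(a * b2) mod int r * int t = a * 1] (mod int r)"
      using cong_trans cong_scalar_left[OF b(2), of a] by blast
    moreover have "V a (r * t) = V (a * b1) t * V (a * b2) r"
      using S[OF True] b by (intro twisted_mult) simp_all
    then have "cmod (V a (r * t)) \<le> Bv * cmod (V ((a * b2) mod int r) r)"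
      using Bv[OF True] by (simp add: norm_mult twisted_mod mult_right_mono)
    ultimately show ?thesis by auto
  qed auto
  then obtain c where c: "\<And>t. t \<in> S \<Longrightarrow> c t \<in> reduced_residues r"
      "\<And>t. t \<in> S \<Longrightarrow> [c t * int t = a] (mod int r)"
      "\<And>t. t \<in> S \<Longrightarrow> cmod (V a (r * t)) \<le> Bv * cmod (V (c t) r)"
    by metis
  have "(\<Sum>t\<in>S. cmod (V a (r * t))) \<le> (\<Sum>t\<in>S. Bv * cmod (V (c t) r))"
    by (intro sum_mono c(3))
  also have "\<dots> = (\<Sum>d\<in>reduced_residues r. \<Sum>t | t \<in> S \<and> c t = d. Bv * cmod (V (c t) r))"
    using c(1) by (intro sum.group[symmetric] assms(1)) auto
  also have "\<dots> \<le> (\<Sum>d\<in>reduced_residues r. Bv * N * cmod (V d r))"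
  proof (rule sum_mono)
    fix d assume d: "d \<in> reduced_residues r"
    then have "coprime d (int r)" by (simp add: reduced_residues_def)
    then obtain d' where d': "[d * d' = 1] (mod int r)" using cong_solve_coprime_int by blast
    \<comment> \<open>Multiplying \<open>d * t = a\<close> modulo \<open>r\<close> by the inverse
      \<open>d'\<close> of \<open>d\<close> recovers the class of \<open>t\<close>.\<close>
    have "{t \<in> S. c t = d} \<subseteq> {t \<in> S. [int t = a * d'] (mod int r)}"
    proof safe
      fix t assume t: "t \<in> S" "d = c t"
      have "[int t * (d * d') = int t * 1] (mod int r)" using d' by (rule cong_scalar_left)
      moreover have "[d * int t * d' = a * d'] (mod int r)"
        using c(2)[OF t(1)] t(2) by (intro cong_scalar_right) simp
      ultimately show "[int t = a * d'] (mod int r)"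
        by (metis cong_sym cong_trans mult.assoc mult.commute mult.right_neutral)
    qed
    then have "card {t \<in> S. c t = d} \<le> card {t \<in> S. [int t = a * d'] (mod int r)}"
      using assms(1) by (intro card_mono) simp_all
    then have "real (card {t \<in> S. c t = d}) \<le> N" using N[of "a * d'"] by linarith
    have "(\<Sum>t | t \<in> S \<and> c t = d. Bv * cmod (V (c t) r)) = real (card {t \<in> S. c t = d}) * (Bv * cmod (V d r))"
      by simp
    also have "\<dots> \<le> N * (Bv * cmod (V d r))"
      using \<open>real (card {t \<in> S. c t = d}) \<le> N\<close> assms(3) by (intro mult_right_mono) simp_all
    finally show "(\<Sum>t | t \<in> S \<and> c t = d. Bv * cmod (V (c t) r)) \<le> Bv * N * cmod (V d r)"
      by (simp add: mult_ac)
  qed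
  also have "\<dots> = Bv * N * residue_norm V r"
    by (simp add: residue_norm_def sum_distrib_left)
  finally show ?thesis .
qed

end

section \<open>Splitting into smooth and rough parts\<close>

text \<open>With \<open>F n\<close> the product of the primes of \<open>q\<close> up to
  \<open>n\<close>, the cut is at the least prime \<open>p\<close> with \<open>F p > X\<close>;
  \<open>r\<close> collects the primes below \<open>p\<close> and \<open>t\<close> those from
  \<open>p\<close> on.\<close>

lemma squarefree_split_at_threshold:
  fixes q :: nat and X :: real
  assumes "squarefree q" "X \<ge> 1" "real q > X"
  obtains p r t where "p \<in> prime_factors q" "q = r * t"
    "\<And>l. l \<in> prime_factors r \<Longrightarrow> l < p" "\<And>l. l \<in> prime_factors t \<Longrightarrow> p \<le> l"
    "real r \<le> X" "X < real r * real p"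
proof -
  let ?P = "prime_factors q"
  define F where "F n = \<Prod>{l \<in> ?P. l \<le> n}" for n
  define A where "A = {p \<in> ?P. real (F p) > X}"
  have fin: "finite ?P" by simp
  have q: "\<Prod>?P = q" by (rule prod_prime_factors_squarefree[OF assms(1)])
  have "?P \<noteq> {}"
  proof
    assume "?P = {}"
    then have "q = 1" using q by (metis prod.empty)
    then show False using assms by simp
  qed
  \<comment> \<open>The product over all the primes is \<open>q\<close>, which exceeds
    \<open>X\<close>, so a threshold prime exists.\<close>
  then have "Max ?P \<in> ?P" "{l \<in> ?P. l \<le> Max ?P} = ?P" by (auto intro: Max_in Max_ge)
  then have "Max ?P \<in> ?P" "F (Max ?P) = q" by (simp_all only: F_def q)
  then have "Max ?P \<in> A" using assms(3) by (simp add: A_def)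
  then have A: "A \<noteq> {}" "finite A" using fin by (auto simp: A_def)
  define p where "p = Min A"
  have pA: "p \<in> A" unfolding p_def using A by (intro Min_in)
  then have pP: "p \<in> ?P" and pX: "real (F p) > X" by (simp_all add: A_def)
  define R where "R = {l \<in> ?P. l < p}"
  define T where "T = {l \<in> ?P. p \<le> l}"
  have RT: "?P = R \<union> T" "R \<inter> T = {}" "finite R" "finite T" by (auto simp: R_def T_def)
  have pr: "prime_factors (\<Prod>R) = R" "prime_factors (\<Prod>T) = T"
    by (rule prime_factors_prod_primes; auto simp: R_def T_def)+
  have "{l \<in> ?P. l \<le> p} = insert p R" using pP by (auto simp: R_def)
  then have Fp: "F p = p * \<Prod>R" using RT(3) by (simp add: F_def R_def)
  \<comment> \<open>This product is \<open>F (Max R)\<close>, and \<open>Max R\<close> lies below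
    the minimum of \<open>A\<close>. If \<open>R\<close> is empty, the product 1 is covered by
    \<open>X \<ge> 1\<close>.\<close>
  have "real (\<Prod>R) \<le> X"
  proof (cases "R = {}")
    case False
    then have m: "Max R \<in> R" using RT(3) by simp
    have "{l \<in> ?P. l \<le> Max R} = R"
      using m Max_ge[OF RT(3)] unfolding R_def by (auto intro: le_less_trans)
    then have "F (Max R) = \<Prod>R" by (simp add: F_def)
    moreover have "Max R \<notin> A"
    proof
      assume "Max R \<in> A"
      then have "p \<le> Max R" unfolding p_def using A(2) by simp
      then show False using m by (simp add: R_def)
    qed
    ultimately show ?thesis using m by (simp add: A_def R_def)
  qed (use assms in simp)
  moreover have "\<Prod>R * \<Prod>T = \<Prod>?P"
    unfolding RT(1) by (rule prod.union_disjoint[OF RT(3,4,2), symmetric])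
  then have "q = \<Prod>R * \<Prod>T" unfolding q by (rule sym)
  moreover have "X < real (\<Prod>R) * real p"
    using pX unfolding Fp by (simp only: of_nat_mult mult.commute)
  moreover have "l < p" if "l \<in> prime_factors (\<Prod>R)" for l
    using that unfolding pr by (simp add: R_def)
  moreover have "p \<le> l" if "l \<in> prime_factors (\<Prod>T)" for l
    using that unfolding pr by (simp add: T_def)
  ultimately show ?thesis using pP that by blast
qed

lemma power_card_prime_factors_le:
  fixes p t :: nat
  assumes "squarefree t" "\<And>l. l \<in> prime_factors t \<Longrightarrow> p \<le> l"
  shows "p ^ card (prime_factors t) \<le> t"
proof -
  have "(\<Prod>l\<in>prime_factors t. p) \<le> \<Prod>(prime_factors t)"
    by (intro prod_mono) (use assms(2) in simp)
  then show ?thesis using prod_prime_factors_squarefree[OF assms(1)] by simp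
qed

text \<open>Refers to the threshold prime only through \<open>v\<close>: its upper bound
  \<open>x powr (1 / real v)\<close> replaces it, both as a bound for the primes of \<open>r\<close>
  and in the lower bound for \<open>r\<close>.\<close>

definition smooth_parts :: "real \<Rightarrow> real \<Rightarrow> nat \<Rightarrow> nat set" where
  "smooth_parts x \<kappa> v = {r. squarefree r \<and> real r \<le> x powr \<kappa> \<and>
     (\<forall>p\<in>prime_factors r. real p \<le> x powr (1 / real v)) \<and> x powr \<kappa> < real r * x powr (1 / real v)}"

text \<open>Here the lower bound \<open>x powr (1 / real (v + 1))\<close> replaces the threshold
  prime; it is strict because \<open>v\<close> is a floor.\<close>

definition rough_parts :: "int \<Rightarrow> real \<Rightarrow> nat \<Rightarrow> nat \<Rightarrow> nat set" where
  "rough_parts a x v r = {t \<in> {1..nat \<lfloor>x / real r\<rfloor>}. squarefree (r * t) \<and> coprime a (int (r * t)) \<and>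
     (\<forall>p. prime p \<longrightarrow> p dvd t \<longrightarrow> x powr (1 / real (v + 1)) < real p) \<and> card (prime_factors t) \<le> v}"

lemma finite_smooth_parts [simp]: "finite (smooth_parts x \<kappa> v)"
  by (rule finite_subset[of _ "{..nat \<lfloor>x powr \<kappa>\<rfloor>}"]) (auto simp: smooth_parts_def le_nat_floor)

lemma finite_rough_parts [simp]: "finite (rough_parts a x v r)"
  by (simp add: rough_parts_def)

text \<open>Cut at \<open>x powr \<kappa>\<close> and let \<open>v\<close> be the floor of
  \<open>ln x / ln (real p)\<close>, which places \<open>p\<close> between the two powers of
  \<open>x\<close> in the definitions. Then \<open>v \<ge> 1\<close> since \<open>p\<close> is at
  most \<open>x\<close>, and \<open>v\<close> is at most \<open>ln x / ln 2\<close> since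
  \<open>p \<ge> 2\<close>.\<close>

lemma smooth_rough_decomposition:
  assumes "x > 1" "\<kappa> > 0" "squarefree q" "coprime a (int q)" "x powr \<kappa> < real q" "real q \<le> x"
  shows "\<exists>v\<in>{1..nat \<lfloor>ln x / ln 2\<rfloor>}. \<exists>r\<in>smooth_parts x \<kappa> v. \<exists>t\<in>rough_parts a x v r. q = r * t"
proof -
  have "x powr \<kappa> \<ge> 1" using assms(1,2) by (simp add: ge_one_powr_ge_zero)
  then obtain p r t where p: "p \<in> prime_factors q" and q: "q = r * t"
    and r: "\<And>l. l \<in> prime_factors r \<Longrightarrow> l < p" and t: "\<And>l. l \<in> prime_factors t \<Longrightarrow> p \<le> l"
    and rX: "real r \<le> x powr \<kappa>" and rp: "x powr \<kappa> < real r * real p"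
    using squarefree_split_at_threshold[OF assms(3) _ assms(5)] by metis
  have "q \<noteq> 0" using assms(3) by (metis not_squarefree_0)
  then have r0: "r > 0" and t0: "t > 0" using q by auto
  have sq: "squarefree r" "squarefree t" using assms(3) squarefree_multD unfolding q by blast+
  have p2: "p \<ge> 2" using p prime_ge_2_nat by (auto simp: in_prime_factors_iff)
  have "p \<le> q" using p \<open>q \<noteq> 0\<close> by (auto simp: in_prime_factors_iff intro: dvd_imp_le)
  then have px: "real p \<le> x" using assms(6) by simp
  have lnp: "ln (real p) > 0" "ln (real p) \<ge> ln 2" using p2 by simp_all
  have lnx: "ln x > 0" using assms(1) by simp
  define v where "v = nat \<lfloor>ln x / ln (real p)\<rfloor>"
  have "1 \<le> ln x / ln (real p)" using px lnp p2 by simp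
  then have v1: "v \<ge> 1" unfolding v_def by (simp add: le_nat_floor)
  have vle: "real v \<le> ln x / ln (real p)" unfolding v_def using lnx lnp by simp
  have vgt: "ln x / ln (real p) < real (v + 1)" unfolding v_def
    using lnx lnp by (simp add: less_eq_real_def) linarith
  have "ln x / ln (real p) \<le> ln x / ln 2" using lnx lnp by (intro divide_left_mono) auto
  then have v2: "v \<le> nat \<lfloor>ln x / ln 2\<rfloor>" using vle by (intro le_nat_floor) linarith
  have pv: "real p \<le> x powr (1 / real v)"
  proof -
    have "ln (real p) \<le> ln x / real v" using vle lnp v1 by (simp add: field_simps)
    then have "exp (ln (real p)) \<le> exp (1 / real v * ln x)" by simp
    then show ?thesis using p2 assms(1) by (simp add: powr_def)
  qed
  have pv': "x powr (1 / real (v + 1)) < real p"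
  proof -
    have "ln x / real (v + 1) < ln (real p)" using vgt lnp by (simp add: field_simps)
    then have "exp (1 / real (v + 1) * ln x) < exp (ln (real p))" by simp
    then show ?thesis using p2 assms(1) by (simp add: powr_def)
  qed
  have "r \<in> smooth_parts x \<kappa> v"
    unfolding smooth_parts_def
  proof (intro CollectI conjI ballI)
    show "real l \<le> x powr (1 / real v)" if "l \<in> prime_factors r" for l
      using r[OF that] pv by simp
    show "x powr \<kappa> < real r * x powr (1 / real v)"
      using rp pv r0 by (meson less_le_trans mult_left_mono of_nat_0_le_iff)
  qed (use sq rX in auto)
  moreover have "t \<in> rough_parts a x v r"
    unfolding rough_parts_def
  proof (intro CollectI conjI allI impI)
    have "real t \<le> x / real r" using assms(6) r0 by (simp add: q field_simps)
    then show "t \<in> {1..nat \<lfloor>x / real r\<rfloor>}" using t0 by (simp add: le_nat_floor)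
    show "x powr (1 / real (v + 1)) < real l" if "prime l" "l dvd t" for l
    proof -
      have "p \<le> l" using that t0 by (intro t) (auto simp: in_prime_factors_iff)
      then show ?thesis using pv' by linarith
    qed
    \<comment> \<open>All primes of \<open>t\<close> are at least \<open>p\<close> and
      \<open>t\<close> is at most \<open>x\<close>, so their number is at most
      \<open>ln x / ln (real p)\<close>.\<close>
    have "p ^ card (prime_factors t) \<le> t" using sq(2) t by (rule power_card_prime_factors_le)
    also have "t \<le> q" using q r0 by simp
    finally have "real (p ^ card (prime_factors t)) \<le> x" using assms(6) by linarith
    then have "ln (real (p ^ card (prime_factors t))) \<le> ln x" using p2 assms(1) by (subst ln_le_cancel_iff) auto
    then have "real (card (prime_factors t)) * ln (real p) \<le> ln x" using p2 by (simp add: ln_realpow)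
    then have "real (card (prime_factors t)) \<le> ln x / ln (real p)" using lnp by (simp add: field_simps)
    then show "card (prime_factors t) \<le> v" unfolding v_def by (rule le_nat_floor)
  qed (use assms q in auto)
  ultimately show ?thesis
    using v1 v2 q by (intro bexI[of _ v] bexI[of _ r] bexI[of _ t]) simp_all
qed

text \<open>Members of \<open>rough_parts\<close> have no prime factor up to a level that is a small
  power of \<open>x\<close>, so the sieve applies; the lower bound for the mass gives the main term,
  and the level is low enough for the remainder to be absorbed.\<close>

lemma card_rough_parts_cong_le:
  fixes e :: int
  assumes "x > 1" "v \<ge> 1" "\<kappa> \<le> 1 / 4" "r \<in> smooth_parts x \<kappa> v"
  shows "real (card {t \<in> rough_parts a x v r. [int t = e] (mod int r)}) \<le>
    15 * real (v + 1) * x / ((real r)\<^sup>2 * ln x) * (\<Prod>p\<in>prime_factors r. 1 + 1 / real p)"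
proof -
  let ?P = "\<Prod>p\<in>prime_factors r. 1 + 1 / real p"
  \<comment> \<open>The 5 makes room for the remainder: \<open>real W ^ 4 * ln u\<close> is at most
    \<open>u ^ 5\<close>, that is \<open>x powr (1 / real (v + 1))\<close>, which is at most the
    square root of \<open>x\<close> as \<open>v \<ge> 1\<close>.\<close>
  define u where "u = x powr (1 / (5 * real (v + 1)))"
  define W where "W = nat \<lfloor>u\<rfloor>"
  define T where "T = nat \<lfloor>x / real r\<rfloor>"
  have sq: "squarefree r" and rx: "real r \<le> x powr \<kappa>" using assms(4) by (simp_all add: smooth_parts_def)
  have r0: "r > 0" using sq by (metis gr0I not_squarefree_0)
  have lnx: "ln x > 0" using assms(1) by simp
  have P1: "?P \<ge> 1" by (intro prod_ge_1) simp
  have u1: "u > 1" unfolding u_def using assms(1) by simp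
  have lnu: "ln u = ln x / (5 * real (v + 1))" unfolding u_def using assms(1) by (simp add: ln_powr)
  have W1: "W \<ge> 1" unfolding W_def using u1 by (simp add: le_nat_floor)
  have Wu: "real W \<le> u" "u < real W + 1" unfolding W_def using u1 by linarith+
  have Tx: "real T \<le> x / real r" unfolding T_def using assms(1) by simp
  have L0: "selberg_mass r W > 0" by (rule selberg_mass_pos[OF W1])
  have "ln u \<le> ln (real W + 1)" using Wu u1 by simp
  also have "\<dots> \<le> 2 * ?P * selberg_mass r W" by (rule selberg_mass_ge[OF sq W1])
  finally have L: "ln u \<le> 2 * ?P * selberg_mass r W" .
  have lnu0: "ln u > 0" using u1 by simp
  \<comment> \<open>With this bound \<open>x / (real r)\<^sup>2\<close> is at least the square root
    of \<open>x\<close> and dominates the remainder.\<close>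
  have r2: "(real r)\<^sup>2 \<le> x powr (1 / 2)"
  proof -
    have "real r \<le> x powr (1 / 4)" using rx powr_mono[OF assms(3), of x] assms(1) by linarith
    then have "(real r)\<^sup>2 \<le> (x powr (1 / 4))\<^sup>2" by (rule power_mono) simp
    also have "\<dots> = x powr (1 / 2)" using assms(1) by (simp add: power2_eq_square powr_add[symmetric])
    finally show ?thesis .
  qed
  have "{t \<in> rough_parts a x v r. [int t = e] (mod int r)} \<subseteq>
      {t \<in> {1..T}. [int t = e] (mod int r) \<and> (\<forall>p. prime p \<longrightarrow> p dvd t \<longrightarrow> p > W)}"
  proof safe
    fix t assume t: "t \<in> rough_parts a x v r"
    then show "t \<in> {1..T}" by (simp add: rough_parts_def T_def)
    fix p assume "prime p" "p dvd t"
    then have "x powr (1 / real (v + 1)) < real p" using t by (simp add: rough_parts_def)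
    moreover have "u \<le> x powr (1 / real (v + 1))"
      unfolding u_def using assms(1) by (intro powr_mono) (auto simp: field_simps)
    ultimately have "real W < real p" using Wu by linarith
    then show "W < p" by simp
  qed
  then have "card {t \<in> rough_parts a x v r. [int t = e] (mod int r)} \<le>
      card {t \<in> {1..T}. [int t = e] (mod int r) \<and> (\<forall>p. prime p \<longrightarrow> p dvd t \<longrightarrow> p > W)}"
    by (intro card_mono) simp_all
  then have "real (card {t \<in> rough_parts a x v r. [int t = e] (mod int r)}) \<le>
      real T / (real r * selberg_mass r W) + real W ^ 4"
    using selberg_sieve_arithmetic_progression[OF r0 W1, of T e] by linarith
  \<comment> \<open>Main term and remainder. The 2 comes from \<open>selberg_mass_ge\<close>; the
    total of 3 becomes 15 through the 5 in \<open>ln u\<close>.\<close>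
  also have "\<dots> \<le> 2 * x / ((real r)\<^sup>2 * ln u) * ?P + x / ((real r)\<^sup>2 * ln u) * ?P"
  proof (rule add_mono)
    have "real T / (real r * selberg_mass r W) \<le> (x / real r) / (real r * selberg_mass r W)"
      using Tx L0 r0 by (intro divide_right_mono) auto
    also have "\<dots> = x / (real r)\<^sup>2 * (1 / selberg_mass r W)" by (simp add: power2_eq_square)
    also have "\<dots> \<le> x / (real r)\<^sup>2 * (2 * ?P / ln u)"
      using L L0 lnu0 assms(1) by (intro mult_left_mono) (auto simp: field_simps)
    finally show "real T / (real r * selberg_mass r W) \<le> 2 * x / ((real r)\<^sup>2 * ln u) * ?P"
      by (simp add: mult_ac)
    have "real W ^ 4 * ln u \<le> u ^ 4 * u"
      using Wu u1 lnu0 ln_le_minus_one[of u] by (intro mult_mono power_mono) auto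
    also have "\<dots> = u powr 5" using u1 by (simp add: powr_numeral eval_nat_numeral)
    also have "\<dots> = x powr (1 / real (v + 1))"
    proof -
      have "1 / (5 * c) * 5 = 1 / c" for c :: real by simp
      from this[of "real (v + 1)"]
      show ?thesis unfolding u_def powr_powr by (simp only:)
    qed
    also have "\<dots> \<le> x powr (1 / 2)" using assms(1,2) by (intro powr_mono) (auto simp: field_simps)
    also have "\<dots> = x / x powr (1 / 2)"
      using assms(1) powr_add[of x "1/2" "1/2"] by (simp add: field_simps)
    also have "\<dots> \<le> x / (real r)\<^sup>2" using r2 r0 assms(1) by (intro divide_left_mono) auto
    finally have "real W ^ 4 \<le> x / (real r)\<^sup>2 / ln u * 1" using lnu0 by (simp add: pos_le_divide_eq del: divide_divide_eq_left)
    also have "\<dots> \<le> x / (real r)\<^sup>2 / ln u * ?P"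
      using P1 lnu0 assms(1) by (intro mult_left_mono) auto
    finally show "real W ^ 4 \<le> x / ((real r)\<^sup>2 * ln u) * ?P" by simp
  qed
  also have "\<dots> = 3 * x / ((real r)\<^sup>2 * ln u) * ?P" by (simp add: field_simps)
  also have "\<dots> = 15 * real (v + 1) * x / ((real r)\<^sup>2 * ln x) * ?P"
    using lnx r0 unfolding lnu by (simp add: field_simps)
  finally show ?thesis .
qed

section \<open>Rankin's trick\<close>

lemma finite_primes_le_real [simp]: "finite {p::nat. prime p \<and> real p \<le> x}"
  by (rule finite_subset[of _ "{..nat \<lfloor>x\<rfloor>}"]) (auto simp: le_nat_floor)

lemma sum_ln_prime_over_prime_le_real:
  fixes x :: real
  assumes "x \<ge> 1"
  shows "(\<Sum>p | prime p \<and> real p \<le> x. ln (real p) / real p) \<le> 2 * ln x"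
proof -
  let ?n = "nat \<lfloor>x\<rfloor>"
  have n: "?n > 0" using assms by simp
  have "{p. prime p \<and> real p \<le> x} = {p. prime p \<and> p \<le> ?n}"
    using assms by (auto simp: le_nat_iff le_floor_iff)
  then have "(\<Sum>p | prime p \<and> real p \<le> x. ln (real p) / real p) \<le> 2 * ln (real ?n)"
    using sum_ln_prime_over_prime_le[OF n] by simp
  also have "\<dots> \<le> 2 * ln x" using assms n by simp
  finally show ?thesis .
qed

lemma sum_prime_inverse_squares_le:
  "(\<Sum>p | prime p \<and> real p \<le> x. 1 / (real p)\<^sup>2) \<le> 2"
proof -
  have "(\<Sum>p | prime p \<and> real p \<le> x. 1 / (real p)\<^sup>2) \<le> (\<Sum>m=1..nat \<lfloor>x\<rfloor>. 1 / (real m)\<^sup>2)"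
    by (intro sum_mono2) (auto simp: le_nat_floor Suc_le_eq prime_gt_0_nat)
  then show ?thesis using sum_inverse_squares_le[of "nat \<lfloor>x\<rfloor>"] by linarith
qed

text \<open>The inequality \<open>1 - y \<le> exp (- y)\<close>, multiplied by
  \<open>exp y\<close>.\<close>

lemma exp_minus_one_le: "exp y - 1 \<le> y * exp (y::real)"
proof -
  have "(1 - y) * exp y \<le> exp (- y) * exp y"
    using exp_ge_add_one_self[of "- y"] by (intro mult_right_mono) simp_all
  then show ?thesis by (simp add: exp_minus algebra_simps)
qed

text \<open>Keeps the Euler factor \<open>1 + b / p\<close> intact and puts the excess
  \<open>D\<close> into an exponential. For \<open>y\<close> equal to \<open>\<delta> * ln p\<close>
  the terms \<open>y / p + 1 / p\<^sup>2\<close> have a bounded sum over the relevant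
  primes.\<close>

lemma smooth_weight_le:
  fixes b p :: real
  assumes "p \<ge> 1" "0 \<le> b" "b \<le> M" "0 \<le> y" "y \<le> c"
  shows "1 + b / p * (1 + 1 / p) * exp y \<le>
    (1 + b / p) * exp (M * exp c * (y / p + 1 / p\<^sup>2))"
proof -
  define D where "D = b / p * ((1 + 1 / p) * exp y - 1)"
  have "exp y \<le> exp c" using assms by simp
  have "(1 + 1 / p) * exp y - 1 = (exp y - 1) + exp y / p" by (simp add: algebra_simps)
  also have "\<dots> \<le> y * exp y + exp y / p" using exp_minus_one_le[of y] by simp
  also have "\<dots> = exp y * (y + 1 / p)" by (simp add: algebra_simps)
  also have "\<dots> \<le> exp c * (y + 1 / p)"
    using \<open>exp y \<le> exp c\<close> assms by (intro mult_right_mono) auto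
  finally have le: "(1 + 1 / p) * exp y - 1 \<le> exp c * (y + 1 / p)" .
  have "exp y * 1 \<le> exp y * (1 + 1 / p)" using assms by (intro mult_left_mono) auto
  moreover have "exp y \<ge> 1" using assms by simp
  ultimately have "exp y * (1 + 1 / p) - 1 \<ge> 0" by linarith
  then have nn: "(1 + 1 / p) * exp y - 1 \<ge> 0" by (simp only: mult.commute)
  have "b / p \<ge> 0" using assms by simp
  then have D0: "D \<ge> 0" unfolding D_def using nn by (rule mult_nonneg_nonneg)
  have "D \<le> M / p * (exp c * (y + 1 / p))"
    unfolding D_def using assms le nn
    by (intro mult_mono divide_right_mono) auto
  also have "\<dots> = M * exp c * (y / p + 1 / p\<^sup>2)"
    using assms by (simp add: field_simps power2_eq_square)
  finally have DM: "D \<le> M * exp c * (y / p + 1 / p\<^sup>2)" .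
  have "1 + b / p * (1 + 1 / p) * exp y = 1 + b / p + D" by (simp add: D_def algebra_simps)
  also have "\<dots> \<le> 1 + b / p + D + b / p * D"
    using mult_nonneg_nonneg[OF \<open>b / p \<ge> 0\<close> D0] by simp
  also have "\<dots> = (1 + b / p) * (1 + D)"
  proof -
    have "1 + z + D + z * D = (1 + z) * (1 + D)" for z by (simp add: algebra_simps)
    then show ?thesis .
  qed
  also have "\<dots> \<le> (1 + b / p) * exp D" using assms exp_ge_add_one_self[of D] by (intro mult_left_mono) auto
  also have "\<dots> \<le> (1 + b / p) * exp (M * exp c * (y / p + 1 / p\<^sup>2))"
    using DM assms by (intro mult_left_mono) auto
  finally show ?thesis .
qed

text \<open>Rankin's trick: members \<open>r\<close> of the set exceed \<open>x powr (\<kappa> - 1 / v)\<close>, so a weight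
  \<open>r powr \<delta>\<close> with \<open>\<delta> = c v / ln x\<close> gains the factor \<open>exp (- c \<kappa> v)\<close>, while \<open>p powr \<delta> \<le> exp c\<close>
  for the primes involved.\<close>

lemma sum_smooth_parts_le:
  fixes g :: "nat \<Rightarrow> real"
  assumes x: "x > 1" and v: "v \<ge> 1" and c: "c \<ge> 0" and M: "M \<ge> 0"
    and g: "\<And>p. prime p \<Longrightarrow> 0 \<le> g p \<and> g p \<le> M"
  shows "(\<Sum>r\<in>smooth_parts x \<kappa> v. \<Prod>p\<in>prime_factors r. g p / real p * (1 + 1 / real p)) \<le>
    exp (c - c * \<kappa> * real v) * exp (2 * M * (c + 1) * exp c) * (\<Prod>p | prime p \<and> real p \<le> x. 1 + g p / real p)"
proof -
  define \<delta> where "\<delta> = c * real v / ln x"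
  define w where "w = x powr (1 / real v)"
  let ?P = "{p. prime p \<and> real p \<le> w}"
  have lnx: "ln x > 0" using x by simp
  have d0: "\<delta> \<ge> 0" using c lnx by (simp add: \<delta>_def)
  have w1: "w \<ge> 1" unfolding w_def using x by (simp add: ge_one_powr_ge_zero)
  have lnw: "ln w = ln x / real v" unfolding w_def using x by (simp add: ln_powr)
  have wx: "w \<le> x" unfolding w_def using x v powr_mono[of "1 / real v" 1 x] by simp
  have pos: "p > 0" if "prime p" for p :: nat using that by (rule prime_gt_0_nat)
  have gp: "0 \<le> g p / real p" if "prime p" for p using g[OF that] by simp
  have gp': "0 \<le> g p / real p * (1 + 1 / real p)" if "prime p" for p
    using gp[OF that] by (rule mult_nonneg_nonneg) simp
  define f where "f p = g p / real p * (1 + 1 / real p) * real p powr \<delta>" for p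
  have "(\<Sum>r\<in>smooth_parts x \<kappa> v. \<Prod>p\<in>prime_factors r. g p / real p * (1 + 1 / real p)) \<le>
      (\<Sum>r\<in>smooth_parts x \<kappa> v. exp (c - c * \<kappa> * real v) * (\<Prod>p\<in>prime_factors r. f p))"
  proof (rule sum_mono)
    fix r assume r: "r \<in> smooth_parts x \<kappa> v"
    have sq: "squarefree r" and rx: "x powr \<kappa> < real r * w"
      using r by (simp_all add: smooth_parts_def w_def)
    have r0: "r > 0" using sq by (metis gr0I not_squarefree_0)
    \<comment> \<open>The last condition in \<open>smooth_parts\<close> bounds \<open>r\<close> from
      below; the loss of \<open>x powr (1 / real v)\<close> costs the factor
      \<open>exp c\<close>.\<close>
    have "x powr (\<kappa> - 1 / real v) \<le> real r"
      using rx w1 x by (simp add: powr_diff w_def field_simps)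
    then have "(x powr (\<kappa> - 1 / real v)) powr \<delta> \<le> real r powr \<delta>" using d0 by (intro powr_mono2) auto
    moreover have "(x powr (\<kappa> - 1 / real v)) powr \<delta> = exp (c * \<kappa> * real v - c)"
      using x lnx v by (simp add: powr_powr powr_def \<delta>_def field_simps)
    ultimately have "exp (c * \<kappa> * real v - c) \<le> real r powr \<delta>" by simp
    then have "exp (c - c * \<kappa> * real v) * exp (c * \<kappa> * real v - c) \<le> exp (c - c * \<kappa> * real v) * real r powr \<delta>"
      by (intro mult_left_mono) auto
    then have one: "1 \<le> exp (c - c * \<kappa> * real v) * real r powr \<delta>" by (simp add: exp_add[symmetric])
    have "real r powr \<delta> = (\<Prod>p\<in>prime_factors r. real p) powr \<delta>"
    proof -
      have "real (\<Prod>(prime_factors r)) = (\<Prod>p\<in>prime_factors r. real p)" by (rule of_nat_prod)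
      then show ?thesis by (simp only: prod_prime_factors_squarefree[OF sq])
    qed
    also have "\<dots> = (\<Prod>p\<in>prime_factors r. real p powr \<delta>)" by (rule prod_powr_distrib)
    finally have rd: "real r powr \<delta> = (\<Prod>p\<in>prime_factors r. real p powr \<delta>)" .
    let ?h = "\<Prod>p\<in>prime_factors r. g p / real p * (1 + 1 / real p)"
    have "?h \<ge> 0"
      by (intro prod_nonneg ballI gp') (simp add: in_prime_factors_iff)
    then have "1 * ?h \<le> exp (c - c * \<kappa> * real v) * real r powr \<delta> * ?h"
      using one by (intro mult_right_mono)
    also have "\<dots> = exp (c - c * \<kappa> * real v) * (\<Prod>p\<in>prime_factors r. f p)"
      unfolding rd f_def prod.distrib by (simp only: mult_ac)
    finally show "?h \<le> exp (c - c * \<kappa> * real v) * (\<Prod>p\<in>prime_factors r. f p)" by simp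
  qed
  also have "\<dots> = exp (c - c * \<kappa> * real v) * (\<Sum>r\<in>smooth_parts x \<kappa> v. \<Prod>p\<in>prime_factors r. f p)"
    by (simp add: sum_distrib_left)
  also have "\<dots> \<le> exp (c - c * \<kappa> * real v) * (\<Prod>p\<in>?P. 1 + f p)"
  proof (rule mult_left_mono)
    show "(\<Sum>r\<in>smooth_parts x \<kappa> v. \<Prod>p\<in>prime_factors r. f p) \<le> (\<Prod>p\<in>?P. 1 + f p)"
    proof (rule sum_squarefree_le_prod)
      show "squarefree r \<and> prime_factors r \<subseteq> ?P" if "r \<in> smooth_parts x \<kappa> v" for r
        using that by (auto simp: smooth_parts_def w_def in_prime_factors_iff)
      show "0 \<le> f p" if "p \<in> ?P" for p
        unfolding f_def using that by (intro mult_nonneg_nonneg[OF gp']) simp_all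
    qed simp
  qed simp
  also have "\<dots> \<le> exp (c - c * \<kappa> * real v) * ((\<Prod>p\<in>?P. 1 + g p / real p) * exp (2 * M * (c + 1) * exp c))"
  proof (rule mult_left_mono)
    have "(\<Prod>p\<in>?P. 1 + f p) \<le>
      (\<Prod>p\<in>?P. (1 + g p / real p) * exp (M * exp c * (\<delta> * ln (real p) / real p + 1 / (real p)\<^sup>2)))"
    proof (rule prod_mono)
      fix p assume p: "p \<in> ?P"
      then have pp: "prime p" "real p \<le> w" by auto
      have p1: "real p \<ge> 1" using pos[OF pp(1)] by simp
      \<comment> \<open>Since \<open>\<delta> * ln w\<close> is exactly \<open>c\<close>,
        \<open>smooth_weight_le\<close> applies with \<open>y\<close> equal to
        \<open>\<delta> * ln (real p)\<close>.\<close>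
      have "\<delta> * ln (real p) \<le> \<delta> * ln w" using p1 pp w1 d0 by (intro mult_left_mono) auto
      also have "\<dots> = c" using lnx v by (simp add: lnw \<delta>_def)
      finally have dc: "\<delta> * ln (real p) \<le> c" .
      have "real p powr \<delta> = exp (\<delta> * ln (real p))" using p1 by (simp add: powr_def)
      then show "0 \<le> 1 + f p \<and> 1 + f p \<le> (1 + g p / real p) *
            exp (M * exp c * (\<delta> * ln (real p) / real p + 1 / (real p)\<^sup>2))"
        using smooth_weight_le[of "real p" "g p" M "\<delta> * ln (real p)" c] p1 g[OF pp(1)] d0 dc gp[OF pp(1)]
        by (simp add: f_def)
    qed
    also have "\<dots> = (\<Prod>p\<in>?P. 1 + g p / real p) *
        exp (M * exp c * (\<delta> * (\<Sum>p\<in>?P. ln (real p) / real p) + (\<Sum>p\<in>?P. 1 / (real p)\<^sup>2)))"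
      by (simp add: prod.distrib exp_sum[symmetric] sum_distrib_left[symmetric] sum.distrib
          times_divide_eq_right[symmetric] del: times_divide_eq_right)
    also have "\<dots> \<le> (\<Prod>p\<in>?P. 1 + g p / real p) * exp (2 * M * (c + 1) * exp c)"
    proof (rule mult_left_mono)
      \<comment> \<open>The weak Mertens bound contributes
        \<open>\<delta> * (2 * ln w) = 2 * c\<close> and the inverse squares at most 2, whence
        \<open>2 * (c + 1)\<close> in the exponent.\<close>
      have "\<delta> * (\<Sum>p\<in>?P. ln (real p) / real p) \<le> \<delta> * (2 * ln w)"
        using d0 sum_ln_prime_over_prime_le_real[OF w1] by (intro mult_left_mono)
      also have "\<dots> = 2 * c" using lnx v by (simp add: lnw \<delta>_def)
      finally have "\<delta> * (\<Sum>p\<in>?P. ln (real p) / real p) + (\<Sum>p\<in>?P. 1 / (real p)\<^sup>2) \<le> 2 * c + 2"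
        using sum_prime_inverse_squares_le[of w] by linarith
      then have "M * exp c * (\<delta> * (\<Sum>p\<in>?P. ln (real p) / real p) + (\<Sum>p\<in>?P. 1 / (real p)\<^sup>2)) \<le> M * exp c * (2 * c + 2)"
        using M by (intro mult_left_mono) auto
      then show "exp (M * exp c * (\<delta> * (\<Sum>p\<in>?P. ln (real p) / real p) + (\<Sum>p\<in>?P. 1 / (real p)\<^sup>2))) \<le>
          exp (2 * M * (c + 1) * exp c)" by (simp add: algebra_simps)
      show "0 \<le> (\<Prod>p\<in>?P. 1 + g p / real p)" using gp by (intro prod_nonneg) (auto intro: add_nonneg_nonneg)
    qed
    finally show "(\<Prod>p\<in>?P. 1 + f p) \<le> (\<Prod>p\<in>?P. 1 + g p / real p) * exp (2 * M * (c + 1) * exp c)" .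
  qed simp
  \<comment> \<open>Passing from \<open>w\<close> to \<open>x\<close> only adds factors that are at
    least 1.\<close>
  also have "\<dots> \<le> exp (c - c * \<kappa> * real v) * ((\<Prod>p | prime p \<and> real p \<le> x. 1 + g p / real p) * exp (2 * M * (c + 1) * exp c))"
  proof (intro mult_left_mono mult_right_mono)
    show "(\<Prod>p\<in>?P. 1 + g p / real p) \<le> (\<Prod>p | prime p \<and> real p \<le> x. 1 + g p / real p)"
    proof (rule prod_mono2)
      show "?P \<subseteq> {p. prime p \<and> real p \<le> x}" using wx by auto
    qed (use gp in \<open>auto intro: add_nonneg_nonneg\<close>)
  qed auto
  finally show ?thesis by (simp only: mult_ac)
qed

section \<open>Decay in \<open>v\<close>\<close>

lemma sum_half_powers_le: "(\<Sum>v=1..n. (1 / 2 :: real) ^ v) \<le> 1"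
proof -
  have "(\<Sum>v=1..n. (1 / 2 :: real) ^ v) = 1 - (1 / 2) ^ n" by (induction n) (auto simp: field_simps)
  then show ?thesis by simp
qed

lemma Suc_le_two_power: "real (v + 1) \<le> 2 ^ v"
proof -
  have "v + 1 \<le> 2 ^ v" using less_exp[of v] by (simp add: Suc_le_eq)
  then have "real (v + 1) \<le> real (2 ^ v)" by (simp only: of_nat_le_iff)
  then show ?thesis by simp
qed

section \<open>The mean value bound\<close>

text \<open>\<open>B \<ge> 0\<close> takes care of the residues divisible by \<open>p\<close>, where
  \<open>V\<close> vanishes.\<close>

lemma twisted_cmod_prime_le:
  assumes tw: "twisted_multiplicative V" and p: "prime p" and "B \<ge> 0"
    and le: "(MAX a\<in>totatives p. cmod (V (int a) p)) \<le> B"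
  shows "cmod (V a p) \<le> B"
proof (cases "coprime a (int p)")
  case True
  then have "a mod int p \<in> reduced_residues p"
    using prime_gt_0_nat[OF p] by (rule mod_in_reduced_residues[rotated])
  then obtain b where b: "b \<in> totatives p" "a mod int p = int b"
    unfolding reduced_residues_prime[OF p] by blast
  have "cmod (V (int b) p) \<le> (MAX a\<in>totatives p. cmod (V (int a) p))"
    using b(1) by (intro Max_ge) auto
  then show ?thesis using le twisted_mod[OF tw, of a p] b(2) by simp
next
  case False
  then show ?thesis using twisted_eq_0[OF tw, of p a] assms(3) by simp
qed

lemma residue_norm_prime_le:
  assumes "prime p" "1 / real p * (\<Sum>a\<in>totatives p. cmod (V (int a) p)) \<le> b"
  shows "residue_norm V p \<le> real p * b"
proof -
  have "residue_norm V p = (\<Sum>a\<in>totatives p. cmod (V (int a) p))"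
    unfolding residue_norm_def reduced_residues_prime[OF assms(1)]
    by (subst sum.reindex) (auto simp: inj_on_def)
  then show ?thesis using assms(2) prime_gt_0_nat[OF assms(1)] by (simp add: field_simps)
qed

text \<open>A squarefree \<open>q\<close> satisfies
  \<open>2 ^ card (prime_factors q) \<le> q\<close>, so the bound \<open>2 ^ A\<close> at primes
  becomes a bound by \<open>q ^ A\<close>, and there are at most \<open>y\<close> terms.\<close>

lemma sum_cmod_small_le:
  fixes y :: real
  assumes tw: "twisted_multiplicative V" and B: "\<And>a p. prime p \<Longrightarrow> cmod (V a p) \<le> 2 ^ A"
    and y: "y \<ge> 0"
  shows "(\<Sum>q | 0 < q \<and> real q \<le> y. cmod (V a q)) \<le> y ^ (A + 1)"
proof -
  have "cmod (V a q) \<le> y ^ A" if "0 < q" "real q \<le> y" for q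
  proof (cases "squarefree q")
    case True
    have "2 ^ card (prime_factors q) \<le> q"
      using True by (rule power_card_prime_factors_le) (auto simp: in_prime_factors_iff prime_ge_2_nat)
    then have "real (2 ^ card (prime_factors q)) \<le> real q" by (rule of_nat_mono)
    then have "real (2 ^ card (prime_factors q)) \<le> y" using that(2) by (rule order_trans)
    then have q2: "2 ^ card (prime_factors q) \<le> y" by simp
    have "cmod (V a q) \<le> (2 ^ A) ^ card (prime_factors q)"
      by (rule twisted_cmod_le_power[OF tw _ B]) simp_all
    also have "\<dots> = (2 ^ card (prime_factors q)) ^ A" by (simp add: power_mult[symmetric] mult.commute)
    also have "\<dots> \<le> y ^ A" using q2 by (intro power_mono) simp_all
    finally show ?thesis .
  next
    case False
    then show ?thesis using twisted_eq_0[OF tw, of q a] y by simp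
  qed
  then have "(\<Sum>q | 0 < q \<and> real q \<le> y. cmod (V a q)) \<le> real (card {q. 0 < q \<and> real q \<le> y}) * y ^ A"
    by (intro sum_bounded_above) simp
  also have "\<dots> \<le> y * y ^ A"
  proof (rule mult_right_mono)
    have "card {q. 0 < q \<and> real q \<le> y} \<le> card {1..nat \<lfloor>y\<rfloor>}"
      by (rule card_mono) (auto simp: le_nat_floor)
    then have "real (card {q. 0 < q \<and> real q \<le> y}) \<le> real (nat \<lfloor>y\<rfloor>)" by simp
    then show "real (card {q. 0 < q \<and> real q \<le> y}) \<le> y" using y by linarith
  qed (use y in simp)
  finally show ?thesis by simp
qed

text \<open>The factor at \<open>t\<close> is at most \<open>B ^ v\<close>, as \<open>t\<close> has
  at most \<open>v\<close> primes. The norm of \<open>V\<close> modulo \<open>r\<close> contributes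
  the product of \<open>real p * g p\<close>, and dividing by \<open>(real r)\<^sup>2\<close> turns
  this into the product of \<open>g p / real p\<close>.\<close>

lemma sum_rough_parts_le:
  fixes g :: "nat \<Rightarrow> real"
  assumes tw: "twisted_multiplicative V" and B: "B \<ge> 1" "\<And>a p. prime p \<Longrightarrow> cmod (V a p) \<le> B"
    and g: "\<And>p. prime p \<Longrightarrow> residue_norm V p \<le> real p * g p"
    and x: "x > 1" and v: "v \<ge> 1" and \<kappa>: "\<kappa> \<le> 1 / 4" and r: "r \<in> smooth_parts x \<kappa> v"
  shows "(\<Sum>t\<in>rough_parts a x v r. cmod (V a (r * t))) \<le>
    15 * x / ln x * (B ^ v * real (v + 1)) * (\<Prod>p\<in>prime_factors r. g p / real p * (1 + 1 / real p))"
proof -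
  define N where "N = 15 * real (v + 1) * x / ((real r)\<^sup>2 * ln x) * (\<Prod>p\<in>prime_factors r. 1 + 1 / real p)"
  have sq: "squarefree r" using r by (simp add: smooth_parts_def)
  have r0: "r > 0" using sq by (metis gr0I not_squarefree_0)
  have N0: "N \<ge> 0" unfolding N_def using x by (intro mult_nonneg_nonneg divide_nonneg_nonneg prod_nonneg) auto
  have "(\<Sum>t\<in>rough_parts a x v r. cmod (V a (r * t))) \<le> B ^ v * N * residue_norm V r"
  proof (rule sum_twisted_cofactors_le[OF tw _ r0])
    show "cmod (V c t) \<le> B ^ v" if "t \<in> rough_parts a x v r" for t c
    proof -
      have "cmod (V c t) \<le> B ^ card (prime_factors t)" by (rule twisted_cmod_le_power[OF tw B])
      also have "\<dots> \<le> B ^ v" using that B(1) by (intro power_increasing) (simp_all add: rough_parts_def)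
      finally show ?thesis .
    qed
    show "real (card {t \<in> rough_parts a x v r. [int t = e] (mod int r)}) \<le> N" for e
      unfolding N_def by (rule card_rough_parts_cong_le[OF x v \<kappa> r])
  qed (use B(1) in \<open>simp_all add: rough_parts_def\<close>)
  also have "\<dots> \<le> B ^ v * N * (\<Prod>p\<in>prime_factors r. real p * g p)"
    using B(1) N0 residue_norm_le_prod[OF tw g sq] by (intro mult_left_mono) simp_all
  also have "\<dots> = 15 * x / ln x * (B ^ v * real (v + 1)) *
      ((\<Prod>p\<in>prime_factors r. 1 + 1 / real p) * (\<Prod>p\<in>prime_factors r. real p * g p) / (real r)\<^sup>2)"
  proof -
    have "k * (15 * s * x / (q * l) * P) * Q = 15 * x / l * (k * s) * (P * Q / q)" for k s q l P Q :: real
      by (simp add: mult_ac)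
    then show ?thesis unfolding N_def .
  qed
  also have "(\<Prod>p\<in>prime_factors r. 1 + 1 / real p) * (\<Prod>p\<in>prime_factors r. real p * g p) / (real r)\<^sup>2 =
      (\<Prod>p\<in>prime_factors r. g p / real p * (1 + 1 / real p))"
  proof -
    have "real (\<Prod>(prime_factors r)) = (\<Prod>p\<in>prime_factors r. real p)" by (rule of_nat_prod)
    then have "(real r)\<^sup>2 = (\<Prod>p\<in>prime_factors r. (real p)\<^sup>2)"
      by (simp only: prod_prime_factors_squarefree[OF sq] prod_power_distrib)
    then have "(\<Prod>p\<in>prime_factors r. 1 + 1 / real p) * (\<Prod>p\<in>prime_factors r. real p * g p) / (real r)\<^sup>2 =
      (\<Prod>p\<in>prime_factors r. (1 + 1 / real p) * (real p * g p) / (real p)\<^sup>2)"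
      by (simp only: prod.distrib prod_dividef)
    also have "\<dots> = (\<Prod>p\<in>prime_factors r. g p / real p * (1 + 1 / real p))"
      by (intro prod.cong refl) (simp add: power2_eq_square)
    finally show ?thesis .
  qed
  finally show ?thesis .
qed

text \<open>By the choice of \<open>c\<close> the Rankin factor
  \<open>exp (- (c * \<kappa> * real v))\<close> is \<open>1 / (4 * B) ^ v\<close>. It cancels
  \<open>B ^ v\<close>; of the remaining \<open>4 ^ v\<close> one factor \<open>2 ^ v\<close>
  absorbs \<open>v + 1\<close> and the other makes the series over \<open>v\<close>
  converge.\<close>

lemma sum_cmod_large_le:
  fixes g :: "nat \<Rightarrow> real"
  assumes tw: "twisted_multiplicative V" and B: "B \<ge> 1" "\<And>a p. prime p \<Longrightarrow> cmod (V a p) \<le> B"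
    and g: "\<And>p. prime p \<Longrightarrow> residue_norm V p \<le> real p * g p" "\<And>p. prime p \<Longrightarrow> 0 \<le> g p \<and> g p \<le> M"
    and x: "x > 1" and \<kappa>: "0 < \<kappa>" "\<kappa> \<le> 1 / 4" and c: "exp (c * \<kappa>) = 4 * B" and M: "M \<ge> 0"
  shows "(\<Sum>q | x powr \<kappa> < real q \<and> real q \<le> x. cmod (V a q)) \<le>
    15 * exp c * exp (2 * M * (c + 1) * exp c) * (x / ln x * (\<Prod>p | prime p \<and> real p \<le> x. 1 + g p / real p))"
proof -
  let ?R = "smooth_parts x \<kappa>" and ?T = "rough_parts a x" and ?N = "nat \<lfloor>ln x / ln 2\<rfloor>"
  let ?E = "exp (2 * M * (c + 1) * exp c)" and ?\<Pi> = "\<Prod>p | prime p \<and> real p \<le> x. 1 + g p / real p"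
  have lnx: "ln x > 0" using x by simp
  have c0: "c \<ge> 0"
  proof -
    have "exp 0 \<le> exp (c * \<kappa>)" using c B(1) by simp
    then have "0 \<le> c * \<kappa>" by (simp only: exp_le_cancel_iff)
    then show ?thesis using \<kappa>(1) by (simp add: zero_le_mult_iff)
  qed
  have \<Pi>0: "?\<Pi> \<ge> 0" using g(2) by (intro prod_nonneg) (auto intro: add_nonneg_nonneg)
  define I where "I = (SIGMA v:{1..?N}. SIGMA r:?R v. ?T v r)"
  define f :: "nat \<times> nat \<times> nat \<Rightarrow> nat" where "f = (\<lambda>(v, r, t). r * t)"
  have finI: "finite I" unfolding I_def by (intro finite_SigmaI) simp_all
  have fin: "finite {q. x powr \<kappa> < real q \<and> real q \<le> x}"
    by (rule finite_subset[of _ "{..nat \<lfloor>x\<rfloor>}"]) (auto simp: le_nat_floor)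
  have "(\<Sum>q | x powr \<kappa> < real q \<and> real q \<le> x. cmod (V a q)) =
      (\<Sum>q | x powr \<kappa> < real q \<and> real q \<le> x \<and> V a q \<noteq> 0. cmod (V a q))"
    by (intro sum.mono_neutral_right fin) auto
  \<comment> \<open>Every \<open>q\<close> with \<open>V a q \<noteq> 0\<close> is
    \<open>r * t\<close> for some triple in \<open>I\<close>; further or repeated products only
    enlarge a sum of nonnegative terms.\<close>
  also have "\<dots> \<le> (\<Sum>q\<in>f ` I. cmod (V a q))"
  proof (rule sum_mono2)
    show "{q. x powr \<kappa> < real q \<and> real q \<le> x \<and> V a q \<noteq> 0} \<subseteq> f ` I"
    proof
      fix q assume "q \<in> {q. x powr \<kappa> < real q \<and> real q \<le> x \<and> V a q \<noteq> 0}"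
      then have q: "x powr \<kappa> < real q" "real q \<le> x" "V a q \<noteq> 0" by simp_all
      then have "squarefree q" "coprime a (int q)" using twisted_eq_0[OF tw] by blast+
      from smooth_rough_decomposition[OF x \<kappa>(1) this q(1,2)]
      obtain v r t where "v \<in> {1..?N}" "r \<in> ?R v" "t \<in> ?T v r" "q = r * t" by metis
      then show "q \<in> f ` I" by (intro image_eqI[of _ _ "(v, r, t)"]) (simp_all add: f_def I_def)
    qed
  qed (use finI in simp_all)
  also have "\<dots> \<le> (\<Sum>i\<in>I. cmod (V a (f i)))"
    using sum_image_le[OF finI, of "\<lambda>q. cmod (V a q)" f] by (simp add: o_def)
  also have "\<dots> = (\<Sum>v=1..?N. \<Sum>r\<in>?R v. \<Sum>t\<in>?T v r. cmod (V a (r * t)))"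
  proof -
    have "(\<Sum>v=1..?N. \<Sum>r\<in>?R v. \<Sum>t\<in>?T v r. cmod (V a (r * t))) =
        (\<Sum>v=1..?N. \<Sum>(r, t)\<in>Sigma (?R v) (?T v). cmod (V a (r * t)))"
      by (intro sum.cong refl sum.Sigma) simp_all
    also have "\<dots> = (\<Sum>(v, y)\<in>I. case y of (r, t) \<Rightarrow> cmod (V a (r * t)))"
      unfolding I_def by (intro sum.Sigma ballI finite_SigmaI) simp_all
    also have "\<dots> = (\<Sum>i\<in>I. cmod (V a (f i)))"
      by (intro sum.cong refl) (auto simp: f_def)
    finally show ?thesis by (rule sym)
  qed
  also have "\<dots> \<le> (\<Sum>v=1..?N. 15 * exp c * ?E * (x / ln x * ?\<Pi>) * (1 / 2) ^ v)"
  proof (rule sum_mono)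
    fix v assume "v \<in> {1..?N}"
    then have v: "v \<ge> 1" by simp
    have "(\<Sum>r\<in>?R v. \<Sum>t\<in>?T v r. cmod (V a (r * t))) \<le>
       (\<Sum>r\<in>?R v. 15 * x / ln x * (B ^ v * real (v + 1)) * (\<Prod>p\<in>prime_factors r. g p / real p * (1 + 1 / real p)))"
      by (intro sum_mono sum_rough_parts_le[OF tw B g(1) x v \<kappa>(2)])
    also have "\<dots> = 15 * x / ln x * (B ^ v * real (v + 1)) *
       (\<Sum>r\<in>?R v. \<Prod>p\<in>prime_factors r. g p / real p * (1 + 1 / real p))"
      by (rule sum_distrib_left[symmetric])
    also have "\<dots> \<le> 15 * x / ln x * (B ^ v * real (v + 1)) * (exp (c - c * \<kappa> * real v) * ?E * ?\<Pi>)"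
      using x B(1) by (intro mult_left_mono sum_smooth_parts_le[OF x v c0 M g(2)]) auto
    also have "\<dots> = 15 * exp c * ?E * (x / ln x * ?\<Pi>) * (B ^ v * real (v + 1) * exp (- (c * \<kappa> * real v)))"
      unfolding diff_conv_add_uminus exp_add by simp
    also have "\<dots> \<le> 15 * exp c * ?E * (x / ln x * ?\<Pi>) * (1 / 2) ^ v"
    proof (rule mult_left_mono)
      have "exp (- (c * \<kappa> * real v)) = 1 / (4 * B) ^ v"
        unfolding c[symmetric] by (simp add: exp_of_nat_mult[symmetric] exp_minus inverse_eq_divide mult_ac)
      then have "B ^ v * real (v + 1) * exp (- (c * \<kappa> * real v)) = real (v + 1) / 4 ^ v"
        using B(1) by (simp add: power_mult_distrib)
      also have "\<dots> \<le> 2 ^ v / 4 ^ v" by (intro divide_right_mono Suc_le_two_power) simp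
      also have "\<dots> = (1 / 2) ^ v" by (simp add: power_divide[symmetric])
      finally show "B ^ v * real (v + 1) * exp (- (c * \<kappa> * real v)) \<le> (1 / 2) ^ v" .
      show "0 \<le> 15 * exp c * ?E * (x / ln x * ?\<Pi>)"
        using \<Pi>0 lnx x by (intro mult_nonneg_nonneg divide_nonneg_nonneg) auto
    qed
    finally show "(\<Sum>r\<in>?R v. \<Sum>t\<in>?T v r. cmod (V a (r * t))) \<le> 15 * exp c * ?E * (x / ln x * ?\<Pi>) * (1 / 2) ^ v" .
  qed
  also have "\<dots> = 15 * exp c * ?E * (x / ln x * ?\<Pi>) * (\<Sum>v=1..?N. (1 / 2) ^ v)"
    by (rule sum_distrib_left[symmetric])
  also have "\<dots> \<le> 15 * exp c * ?E * (x / ln x * ?\<Pi>) * 1"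
    using \<Pi>0 lnx x by (intro mult_left_mono sum_half_powers_le mult_nonneg_nonneg divide_nonneg_nonneg) auto
  finally show ?thesis by simp
qed

text \<open>The inequality \<open>ln y \<le> y - 1\<close> at half the square root of
  \<open>x\<close>, together with \<open>ln 2 \<le> 1\<close>.\<close>

lemma sqrt_le_div_ln:
  fixes x :: real
  assumes "x > 1"
  shows "x powr (1 / 2) \<le> x / ln x"
proof -
  have "ln (x powr (1 / 2) / 2) \<le> x powr (1 / 2) / 2 - 1"
    using assms by (intro ln_le_minus_one) simp
  moreover have "ln (x powr (1 / 2) / 2) = ln x / 2 - ln 2"
    using assms by (simp add: ln_div ln_powr)
  moreover have "ln 2 \<le> (1 :: real)" using ln_le_minus_one[of "2 :: real"] by simp
  ultimately have "ln x \<le> x powr (1 / 2)" by simp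
  then have "x powr (1 / 2) * ln x \<le> x powr (1 / 2) * x powr (1 / 2)" by (intro mult_left_mono) simp_all
  also have "\<dots> = x" using assms by (simp add: powr_add[symmetric])
  finally show ?thesis using assms by (simp add: field_simps)
qed

theorem theorem1p4:
  fixes M :: real
  assumes "M > 0"
  shows "\<exists>C>0. \<exists>x0. \<forall>(V :: int \<Rightarrow> nat \<Rightarrow> complex) (G :: nat \<Rightarrow> real) (g :: nat \<Rightarrow> real).
           twisted_multiplicative V \<longrightarrow>
           (\<forall>p. prime p \<longrightarrow>
              G p \<ge> g p \<and> g p \<ge> 0 \<and>
              (MAX a\<in>totatives p. cmod (V (int a) p)) \<le> G p \<and>
              1 / real p * (\<Sum>a\<in>totatives p. cmod (V (int a) p)) \<le> g p \<and>
              G p \<le> M) \<longrightarrow>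
           (\<forall>a::int. a \<ge> 1 \<longrightarrow>
              (\<forall>x::real. x \<ge> x0 \<longrightarrow>
                 (\<Sum>q | 0 < q \<and> real q \<le> x. cmod (V a q))
                   \<le> C * (x / ln x * (\<Prod>p | prime p \<and> real p \<le> x. 1 + g p / real p)
                          * ln (ln x) powr M)))"
proof -
  obtain n :: nat where "M < real n" using reals_Archimedean2 by blast
  also have "real n \<le> 2 ^ (n + 1)" using less_exp[of "n + 1"]
    by (metis add_lessD1 less_imp_le of_nat_le_iff of_nat_numeral of_nat_power)
  finally have MA: "M \<le> 2 ^ (n + 1)" by simp
  \<comment> \<open>Taking \<open>n + 1\<close> ensures \<open>A \<ge> 1\<close>, which gives
    \<open>\<kappa> \<le> 1 / 4\<close>.\<close>
  define A where "A = n + 1"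
  \<comment> \<open>Chosen so that \<open>(x powr \<kappa>) ^ (A + 1)\<close>, the bound for small
    \<open>q\<close>, is the square root of \<open>x\<close>.\<close>
  define \<kappa> :: real where "\<kappa> = 1 / (2 * real (A + 1))"
  define c where "c = ln (4 * 2 ^ A) / \<kappa>"
  define K where "K = 15 * exp c * exp (2 * M * (c + 1) * exp c)"
  have \<kappa>: "0 < \<kappa>" "\<kappa> \<le> 1 / 4" by (simp_all add: \<kappa>_def A_def field_simps)
  have c: "exp (c * \<kappa>) = 4 * 2 ^ A" using \<kappa>(1) by (simp add: c_def)
  \<comment> \<open>\<open>K\<close> comes from the large \<open>q\<close> and the 1 from the small
    ones; neither depends on \<open>V\<close>, \<open>G\<close>, \<open>g\<close> or
    \<open>a\<close>. The threshold \<open>exp (exp 1)\<close> is where \<open>ln (ln x)\<close>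
    reaches 1.\<close>
  have "(\<Sum>q | 0 < q \<and> real q \<le> x. cmod (V a q)) \<le>
      (K + 1) * (x / ln x * (\<Prod>p | prime p \<and> real p \<le> x. 1 + g p / real p) * ln (ln x) powr M)"
    if tw: "twisted_multiplicative V"
      and hyp: "\<forall>p. prime p \<longrightarrow>
              G p \<ge> g p \<and> g p \<ge> 0 \<and>
              (MAX a\<in>totatives p. cmod (V (int a) p)) \<le> G p \<and>
              1 / real p * (\<Sum>a\<in>totatives p. cmod (V (int a) p)) \<le> g p \<and>
              G p \<le> M"
      and xe: "x \<ge> exp (exp 1)" for V :: "int \<Rightarrow> nat \<Rightarrow> complex" and G g :: "nat \<Rightarrow> real" and a x
  proof -
    let ?\<Pi> = "\<Prod>p | prime p \<and> real p \<le> x. 1 + g p / real p"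
    have "exp 0 < exp (exp (1 :: real))" by (simp only: exp_less_cancel_iff exp_gt_zero)
    then have "1 < exp (exp (1 :: real))" by (simp only: exp_zero)
    then have x: "x > 1" using xe by (rule less_le_trans)
    have "ln (exp (exp 1)) \<le> ln x" using xe by (subst ln_le_cancel_iff) (use x in auto)
    then have lnx: "ln x \<ge> exp 1" by simp
    then have "ln (exp 1) \<le> ln (ln x)" by (subst ln_le_cancel_iff) (auto intro: less_le_trans[OF exp_gt_zero])
    then have LL: "ln (ln x) powr M \<ge> 1" using assms by (simp add: ge_one_powr_ge_zero)
    have hypD: "g p \<le> G p" "0 \<le> g p" "(MAX a\<in>totatives p. cmod (V (int a) p)) \<le> G p"
        "1 / real p * (\<Sum>a\<in>totatives p. cmod (V (int a) p)) \<le> g p" "G p \<le> M" if "prime p" for p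
      using hyp[rule_format, OF that] by blast+
    have B: "cmod (V a p) \<le> 2 ^ A" if "prime p" for a p
    proof (rule twisted_cmod_prime_le[OF tw that])
      show "(MAX a\<in>totatives p. cmod (V (int a) p)) \<le> 2 ^ A"
        using hypD(3,5)[OF that] MA unfolding A_def by linarith
    qed simp
    have g: "residue_norm V p \<le> real p * g p" if "prime p" for p
      using that hypD(4)[OF that] by (rule residue_norm_prime_le)
    have gM: "0 \<le> g p \<and> g p \<le> M" if "prime p" for p
      using hypD(1,2,5)[OF that] by linarith
    have "?\<Pi> \<ge> 1" using gM by (intro prod_ge_1) simp
    have \<kappa>x: "x powr \<kappa> \<le> x" using powr_mono[of \<kappa> 1 x] \<kappa> x by simp
    have "(\<Sum>q | 0 < q \<and> real q \<le> x. cmod (V a q)) =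
        (\<Sum>q\<in>{q. 0 < q \<and> real q \<le> x powr \<kappa>} \<union> {q. x powr \<kappa> < real q \<and> real q \<le> x}. cmod (V a q))"
    proof (rule sum.cong)
      show "{q. 0 < q \<and> real q \<le> x} = {q. 0 < q \<and> real q \<le> x powr \<kappa>} \<union> {q. x powr \<kappa> < real q \<and> real q \<le> x}"
        using \<kappa>x x by (auto intro!: Nat.gr0I)
    qed simp
    also have "\<dots> = (\<Sum>q | 0 < q \<and> real q \<le> x powr \<kappa>. cmod (V a q)) +
        (\<Sum>q | x powr \<kappa> < real q \<and> real q \<le> x. cmod (V a q))"
    proof (rule sum.union_disjoint)
      show "finite {q. 0 < q \<and> real q \<le> x powr \<kappa>}"
        by (rule finite_subset[of _ "{..nat \<lfloor>x powr \<kappa>\<rfloor>}"]) (auto simp: le_nat_floor)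
      show "finite {q. x powr \<kappa> < real q \<and> real q \<le> x}"
        by (rule finite_subset[of _ "{..nat \<lfloor>x\<rfloor>}"]) (auto simp: le_nat_floor)
    qed auto
    also have "\<dots> \<le> x / ln x * ?\<Pi> + K * (x / ln x * ?\<Pi>)"
    proof (rule add_mono)
      have "(\<Sum>q | 0 < q \<and> real q \<le> x powr \<kappa>. cmod (V a q)) \<le> (x powr \<kappa>) ^ (A + 1)"
        by (rule sum_cmod_small_le[OF tw B]) simp_all
      also have "\<dots> = x powr (\<kappa> * real (A + 1))" using x by (simp only: powr_realpow[symmetric] powr_powr powr_gt_zero)
      also have "\<kappa> * real (A + 1) = 1 / 2" by (simp add: \<kappa>_def field_simps)
      also have "x powr (1 / 2) \<le> x / ln x * 1" using sqrt_le_div_ln[OF x] by simp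
      also have "\<dots> \<le> x / ln x * ?\<Pi>" using \<open>?\<Pi> \<ge> 1\<close> x by (intro mult_left_mono) auto
      finally show "(\<Sum>q | 0 < q \<and> real q \<le> x powr \<kappa>. cmod (V a q)) \<le> x / ln x * ?\<Pi>" .
      show "(\<Sum>q | x powr \<kappa> < real q \<and> real q \<le> x. cmod (V a q)) \<le> K * (x / ln x * ?\<Pi>)"
        unfolding K_def using assms by (intro sum_cmod_large_le[OF tw _ B g gM x \<kappa> c]) simp_all
    qed
    also have "\<dots> = (K + 1) * (x / ln x * ?\<Pi> * 1)"
      by (simp only: distrib_right mult_1_left mult_1_right add.commute)
    \<comment> \<open>\<open>ln (ln x) powr M\<close> is at least 1 here, so it can replace the
      factor 1.\<close>
    also have "\<dots> \<le> (K + 1) * (x / ln x * ?\<Pi> * ln (ln x) powr M)"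
      using LL \<open>?\<Pi> \<ge> 1\<close> x by (intro mult_left_mono) (auto simp: K_def)
    finally show ?thesis .
  qed
  moreover have "K + 1 > 0" by (simp add: K_def add_pos_pos)
  ultimately show ?thesis by blast
qed

end
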